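(* Let $k\ge3$, $\delta\in\mathbb{C}^*$, $d\ge2$, and let $S(z_1,\dots,z_k)=(z_2,\dots,z_k,\delta(z_2^d-z_1))$ (a shift-like automorphism of $\mathbb{C}^k$ of type $k-1$), with positive Green's function $G^+(z)=\lim_{n\to\infty}\frac1{d^n}\log^+\|S^{(k-1)n}(z)\|$. Then for every $c>0$ and every algebraic variety $\widetilde V\subset\mathbb{C}^k$ of codimension $2$, there exists a change of coordinates, i.e. an automorphism $\Phi$ of $\mathbb{C}^k$, such that $\{z\in\mathbb{C}^k: G^+(z)<c\}\cap\Phi(\widetilde V)=\emptyset$.
   Context: $\log^+t=\max(\log t,0)$ and $S^m$ is the $m$-th iterate of $S$. *)

theory Defs
  imports "HOL-Analysis.Analysis"
begin

text \<open>Points of C^k are vectors complex^'n, where the finite linearly ordered index type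
  'n has k = CARD('n) elements; the coordinates z_1,...,z_k are the entries at the indices
  listed in increasing order.\<close>

definition coord_list :: "'n::{finite,linorder} list" where
  "coord_list = sorted_list_of_set (UNIV :: 'n set)"

text \<open>The i-th coordinate (0-based), i.e. z_(i+1).\<close>
definition zc :: "complex ^ 'n::{finite,linorder} \<Rightarrow> nat \<Rightarrow> complex" where
  "zc z i = z $ (coord_list ! i)"

text \<open>Index j has position card {j'. j' < j} (0-based). The shift-like map S(z_1,...,z_k) = (z_2,...,z_k, delta (z_2^d - z_1)).\<close>
definition shift_map :: "complex \<Rightarrow> nat \<Rightarrow> (complex, 'n::{finite,linorder}) vec \<Rightarrow> (complex, 'n) vec" where
  "shift_map \<delta> d z = (\<chi> j. let i = card {j'. j' < j} in
      if i + 1 < CARD('n::{finite,linorder}) then zc z (i + 1) else \<delta> * ((zc z 1) ^ d - zc z 0))"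

definition logplus :: "real \<Rightarrow> real" where
  "logplus t = (if t \<le> 1 then 0 else ln t)"

definition green_plus :: "complex \<Rightarrow> nat \<Rightarrow> complex ^ 'n::{finite,linorder} \<Rightarrow> real" where
  "green_plus \<delta> d z =
     lim (\<lambda>n. logplus (norm (((shift_map \<delta> d) ^^ ((CARD('n::{finite,linorder}) - 1) * n)) z)) / real d ^ n)"

definition holomorphic_map :: "(complex ^ 'n::finite \<Rightarrow> complex ^ 'n) \<Rightarrow> bool" where
  "holomorphic_map F \<longleftrightarrow> (\<forall>z. \<exists>D. (F has_derivative D) (at z) \<and>
        (\<forall>(c::complex) v. D (c *s v) = c *s D v))"

definition automorphism :: "(complex ^ 'n::finite \<Rightarrow> complex ^ 'n) \<Rightarrow> bool" where
  "automorphism F \<longleftrightarrow> bij F \<and> holomorphic_map F \<and> holomorphic_map (inv F)"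

definition poly_fun :: "(complex ^ 'n::finite \<Rightarrow> complex) \<Rightarrow> bool" where
  "poly_fun f \<longleftrightarrow> (\<exists>(A :: ('n \<Rightarrow> nat) set) (a :: ('n \<Rightarrow> nat) \<Rightarrow> complex). finite A \<and>
      (\<forall>z. f z = (\<Sum>\<alpha>\<in>A. a \<alpha> * (\<Prod>i\<in>UNIV. (z $ i) ^ (\<alpha> i)))))"

definition algebraic_set :: "(complex ^ 'n::finite) set \<Rightarrow> bool" where
  "algebraic_set V \<longleftrightarrow> (\<exists>P. (\<forall>f\<in>P. poly_fun f) \<and> V = {z. \<forall>f\<in>P. f z = 0})"

definition irreducible_alg :: "(complex ^ 'n::finite) set \<Rightarrow> bool" where
  "irreducible_alg V \<longleftrightarrow> algebraic_set V \<and> V \<noteq> {} \<and>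
     (\<forall>A B. algebraic_set A \<longrightarrow> algebraic_set B \<longrightarrow> V = A \<union> B \<longrightarrow> V = A \<or> V = B)"

definition alg_dim :: "(complex ^ 'n::finite) set \<Rightarrow> nat" where
  "alg_dim V = Sup {n. \<exists>C :: nat \<Rightarrow> (complex ^ 'n) set.
      (\<forall>i\<le>n. irreducible_alg (C i) \<and> C i \<subseteq> V) \<and> (\<forall>i<n. C i \<subset> C (Suc i))}"

end

theory Submission
  imports Defs "HOL-Computational_Algebra.Fundamental_Theorem_Algebra" "HOL-Library.Function_Algebras"
begin

text \<open>
  The Green function is at least \<open>c\<close> on the set \<open>W\<close> of points where some coordinate
  \<open>z\<^sub>2, \<dots>, z\<^sub>k\<close> has modulus at least \<open>max R \<bar>z\<^sub>1\<bar>\<close>: there each block of \<open>k - 1\<close> iterations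
  raises the maximal modulus to the power \<open>d\<close> up to constant factors. So it suffices to move \<open>V\<close> into \<open>W\<close>,
  and an affine map does this. Choose a polynomial \<open>f\<close> vanishing on \<open>V\<close> and a direction \<open>v\<close> in
  which \<open>f\<close> is monic. Then the projection along \<open>v\<close> is proper on \<open>V\<close>, with the fibre coordinate bounded
  linearly in the base point. If the projection misses a point, it misses a neighbourhood of it, and
  stretching the base around that point moves \<open>V\<close> into \<open>W\<close>.

  If the projection were onto, the dimension of \<open>V\<close> would be at least \<open>k - 1\<close>: minimal algebraic subsets
  of \<open>V\<close> lying over a flag of coordinate subspaces are irreducible, because the projection is Zariski
  closed, and they form a chain of length \<open>k - 1\<close>. Such a chain bounds the dimension, a supremum
  of chain lengths, only if these are bounded: along a strict chain of \<open>n\<close> steps there are \<open>n\<close>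
  polynomials whose monomials are linearly independent, which forces \<open>n \<le> k\<close> by counting.
\<close>

section \<open>Polynomial functions\<close>

lemma poly_fun_monomial: "poly_fun (\<lambda>z::complex^'n::finite. c * (\<Prod>i\<in>UNIV. (z $ i) ^ (\<alpha> i)))"
  unfolding poly_fun_def by (rule exI[of _ "{\<alpha>}"], rule exI[of _ "\<lambda>_. c"]) simp

lemma poly_fun_const [simp]: "poly_fun (\<lambda>z::complex^'n::finite. c)"
  using poly_fun_monomial[of c "\<lambda>_. 0"] by simp

lemma poly_fun_add:
  assumes "poly_fun f" "poly_fun g"
  shows "poly_fun (\<lambda>z::complex^'n::finite. f z + g z)"
proof -
  from assms(1) obtain A a where A: "finite A" "\<And>z. f z = (\<Sum>\<alpha>\<in>A. a \<alpha> * (\<Prod>i\<in>UNIV. (z $ i) ^ (\<alpha> i)))"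
    unfolding poly_fun_def by blast
  from assms(2) obtain B b where B: "finite B" "\<And>z. g z = (\<Sum>\<alpha>\<in>B. b \<alpha> * (\<Prod>i\<in>UNIV. (z $ i) ^ (\<alpha> i)))"
    unfolding poly_fun_def by blast
  \<comment> \<open>The coefficients \<open>a\<close> and \<open>b\<close> are arbitrary outside
    \<open>A\<close> and \<open>B\<close>, so each is cut off to zero before they are added over the
    union.\<close>
  define e where "e = (\<lambda>\<alpha>. (if \<alpha> \<in> A then a \<alpha> else 0) + (if \<alpha> \<in> B then b \<alpha> else 0))"
  have "f z + g z = (\<Sum>\<alpha>\<in>A \<union> B. e \<alpha> * (\<Prod>i\<in>UNIV. (z $ i) ^ (\<alpha> i)))" for z
  proof -
    have "f z = (\<Sum>\<alpha>\<in>A \<union> B. (if \<alpha> \<in> A then a \<alpha> else 0) * (\<Prod>i\<in>UNIV. (z $ i) ^ (\<alpha> i)))"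
      unfolding A(2) using A(1) B(1) by (intro sum.mono_neutral_cong_left) auto
    moreover have "g z = (\<Sum>\<alpha>\<in>A \<union> B. (if \<alpha> \<in> B then b \<alpha> else 0) * (\<Prod>i\<in>UNIV. (z $ i) ^ (\<alpha> i)))"
      unfolding B(2) using A(1) B(1) by (intro sum.mono_neutral_cong_left) auto
    ultimately show ?thesis
      by (simp add: e_def sum.distrib[symmetric] distrib_right)
  qed
  moreover have "finite (A \<union> B)" using A B by simp
  ultimately show ?thesis unfolding poly_fun_def by blast
qed

lemma poly_fun_sum:
  "(\<And>x. x \<in> X \<Longrightarrow> poly_fun (f x)) \<Longrightarrow> poly_fun (\<lambda>z::complex^'n::finite. \<Sum>x\<in>X. f x z)"
  by (induction X rule: infinite_finite_induct) (auto intro: poly_fun_add)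

lemma poly_fun_mult:
  assumes "poly_fun f" "poly_fun g"
  shows "poly_fun (\<lambda>z::complex^'n::finite. f z * g z)"
proof -
  from assms(1) obtain A a where A: "finite A" "\<And>z. f z = (\<Sum>\<alpha>\<in>A. a \<alpha> * (\<Prod>i\<in>UNIV. (z $ i) ^ (\<alpha> i)))"
    unfolding poly_fun_def by blast
  from assms(2) obtain B b where B: "finite B" "\<And>z. g z = (\<Sum>\<alpha>\<in>B. b \<alpha> * (\<Prod>i\<in>UNIV. (z $ i) ^ (\<alpha> i)))"
    unfolding poly_fun_def by blast
  have "(\<lambda>z. f z * g z) =
      (\<lambda>z. \<Sum>\<alpha>\<in>A. \<Sum>\<beta>\<in>B. (a \<alpha> * b \<beta>) * (\<Prod>i\<in>UNIV. (z $ i) ^ (\<alpha> i + \<beta> i)))"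
    by (simp add: A(2) B(2) sum_product power_add prod.distrib mult_ac)
  moreover have "poly_fun \<dots>" by (intro poly_fun_sum poly_fun_monomial)
  ultimately show ?thesis by simp
qed

lemma poly_fun_coord [simp]: "poly_fun (\<lambda>z::complex^'n::finite. z $ i)"
proof -
  have "(\<Prod>j\<in>UNIV. (z $ j) ^ (if j = i then 1 else 0)) = z $ i" for z :: "complex^'n"
    using prod.delta[of UNIV i "\<lambda>j. z $ j"]
    by (simp add: if_distrib[of "\<lambda>m. _ ^ m"] cong: if_cong)
  then show ?thesis using poly_fun_monomial[of 1 "\<lambda>j. if j = i then 1 else 0"] by simp
qed

lemma poly_fun_power: "poly_fun f \<Longrightarrow> poly_fun (\<lambda>z::complex^'n::finite. f z ^ m)"
  by (induction m) (auto intro: poly_fun_mult)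

lemma poly_fun_prod:
  "(\<And>x. x \<in> X \<Longrightarrow> poly_fun (f x)) \<Longrightarrow> poly_fun (\<lambda>z::complex^'n::finite. \<Prod>x\<in>X. f x z)"
  by (induction X rule: infinite_finite_induct) (auto intro: poly_fun_mult)

lemma poly_fun_diff:
  assumes "poly_fun f" "poly_fun g"
  shows "poly_fun (\<lambda>z::complex^'n::finite. f z - g z)"
  using poly_fun_add[OF assms(1) poly_fun_mult[OF poly_fun_const[of "-1"] assms(2)]] by simp

text \<open>Expanding the finite sum into generators lets later properties be checked on constants,
  coordinates, sums and products only.\<close>

lemma poly_fun_induct [consumes 1, case_names const coord add mult]:
  assumes "poly_fun (f :: complex^'n::finite \<Rightarrow> complex)"
    and c: "\<And>c. P (\<lambda>_. c)" and x: "\<And>i. P (\<lambda>z. z $ i)"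
    and a: "\<And>f g. P f \<Longrightarrow> P g \<Longrightarrow> P (\<lambda>z. f z + g z)"
    and m: "\<And>f g. P f \<Longrightarrow> P g \<Longrightarrow> P (\<lambda>z. f z * g z)"
  shows "P f"
proof -
  from assms(1) obtain A a where A: "finite A" "\<And>z. f z = (\<Sum>\<alpha>\<in>A. a \<alpha> * (\<Prod>i\<in>UNIV. (z $ i) ^ (\<alpha> i)))"
    unfolding poly_fun_def by blast
  have pow: "P (\<lambda>z. (z $ i) ^ e)" for i e
    by (induction e) (auto intro: c x m)
  have prod: "P (\<lambda>z. \<Prod>i\<in>I. (z $ i) ^ (\<alpha> i))" for I :: "'n set" and \<alpha>
    by (induction I rule: infinite_finite_induct) (auto intro: c m pow)
  have "P (\<lambda>z. \<Sum>\<alpha>\<in>A. a \<alpha> * (\<Prod>i\<in>UNIV. (z $ i) ^ (\<alpha> i)))"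
    using A(1) by (induction A) (auto intro!: c m prod assms(4))
  moreover have "f = (\<lambda>z. \<Sum>\<alpha>\<in>A. a \<alpha> * (\<Prod>i\<in>UNIV. (z $ i) ^ (\<alpha> i)))"
    using A(2) by blast
  ultimately show ?thesis by simp
qed

lemma poly_fun_compose:
  assumes "poly_fun f" "\<And>i. poly_fun (\<lambda>z. F z $ i)"
  shows "poly_fun (\<lambda>z::complex^'n::finite. f (F z))"
  using assms(1) by (induction rule: poly_fun_induct) (auto intro: assms(2) poly_fun_add poly_fun_mult)

lemma poly_fun_continuous:
  "poly_fun f \<Longrightarrow> continuous_on UNIV (f :: complex^'n::finite \<Rightarrow> complex)"
  by (induction rule: poly_fun_induct) (auto intro!: continuous_intros)

section \<open>Restriction to parallel lines\<close>

text \<open>On every line in direction \<open>v\<close>, the function \<open>f\<close> is a polynomial of degree at most \<open>D\<close> whose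
  coefficient at \<open>D\<close> is \<open>\<tau>\<close>, independently of the line: for \<open>\<tau> \<noteq> 0\<close>, \<open>f\<close> is monic up to scaling.\<close>
definition line_poly :: "complex^'n::finite \<Rightarrow> (complex^'n \<Rightarrow> complex) \<Rightarrow> nat \<Rightarrow> complex \<Rightarrow> bool" where
  "line_poly v f D \<tau> \<longleftrightarrow> (\<exists>P. (\<forall>w s. poly (P w) s = f (w + s *s v)) \<and>
     (\<forall>l. poly_fun (\<lambda>w. coeff (P w) l)) \<and> (\<forall>w. degree (P w) \<le> D \<and> coeff (P w) D = \<tau>))"

lemma line_poly_const: "line_poly v (\<lambda>_. c) 0 c"
  unfolding line_poly_def by (rule exI[of _ "\<lambda>_. [:c:]"]) auto

lemma line_poly_coord: "line_poly v (\<lambda>z. z $ i) 1 (v $ i)"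
proof -
  have "poly_fun (\<lambda>w. coeff [:w $ i, v $ i:] l)" for l
    by (cases l; cases "l - 1") (auto simp: coeff_pCons split: nat.split)
  then show ?thesis
    unfolding line_poly_def by (intro exI[of _ "\<lambda>w. [:w $ i, v $ i:]"]) auto
qed

lemma line_poly_add:
  assumes "line_poly v f D a" "line_poly v g D b"
  shows "line_poly v (\<lambda>z. f z + g z) D (a + b)"
proof -
  from assms(1) obtain P where P: "\<And>w s. poly (P w) s = f (w + s *s v)"
     "\<And>l. poly_fun (\<lambda>w. coeff (P w) l)" "\<And>w. degree (P w) \<le> D" "\<And>w. coeff (P w) D = a"
    unfolding line_poly_def by blast
  from assms(2) obtain Q where Q: "\<And>w s. poly (Q w) s = g (w + s *s v)"
     "\<And>l. poly_fun (\<lambda>w. coeff (Q w) l)" "\<And>w. degree (Q w) \<le> D" "\<And>w. coeff (Q w) D = b"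
    unfolding line_poly_def by blast
  show ?thesis unfolding line_poly_def
    by (rule exI[of _ "\<lambda>w. P w + Q w"]) (use P Q in \<open>auto intro: degree_add_le poly_fun_add\<close>)
qed

text \<open>Every other term of the convolution has a factor above its degree bound. The bounds need
  not be attained, so zero coefficients are allowed.\<close>

lemma coeff_mult_top:
  fixes p q :: "'a::comm_semiring_1 poly"
  assumes "degree p \<le> m" "degree q \<le> n"
  shows "coeff (p * q) (m + n) = coeff p m * coeff q n"
proof -
  have "coeff p i * coeff q (m + n - i) = (if i = m then coeff p m * coeff q n else 0)"
    if "i \<le> m + n" for i
  proof (cases i m rule: linorder_cases)
    case less
    then have "degree q < m + n - i" using assms(2) that by linarith
    then show ?thesis using less by (simp add: coeff_eq_0)
  next
    case greater
    then show ?thesis using assms(1) by (simp add: coeff_eq_0)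
  qed simp
  then have "coeff (p * q) (m + n) = (\<Sum>i\<le>m + n. if i = m then coeff p m * coeff q n else 0)"
    unfolding coeff_mult by (intro sum.cong) auto
  then show ?thesis by simp
qed

lemma line_poly_mult:
  assumes "line_poly v f D a" "line_poly v g E b"
  shows "line_poly v (\<lambda>z. f z * g z) (D + E) (a * b)"
proof -
  from assms(1) obtain P where P: "\<And>w s. poly (P w) s = f (w + s *s v)"
     "\<And>l. poly_fun (\<lambda>w. coeff (P w) l)" "\<And>w. degree (P w) \<le> D" "\<And>w. coeff (P w) D = a"
    unfolding line_poly_def by blast
  from assms(2) obtain Q where Q: "\<And>w s. poly (Q w) s = g (w + s *s v)"
     "\<And>l. poly_fun (\<lambda>w. coeff (Q w) l)" "\<And>w. degree (Q w) \<le> E" "\<And>w. coeff (Q w) E = b"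
    unfolding line_poly_def by blast
  have "degree (P w * Q w) \<le> D + E" for w
    by (meson P(3) Q(3) add_mono degree_mult_le order_trans)
  moreover have "coeff (P w * Q w) (D + E) = a * b" for w
    using coeff_mult_top[OF P(3) Q(3)] P(4) Q(4) by simp
  moreover have "poly_fun (\<lambda>w. coeff (P w * Q w) l)" for l
    unfolding coeff_mult by (intro poly_fun_sum poly_fun_mult P Q)
  ultimately show ?thesis unfolding line_poly_def
    by (intro exI[of _ "\<lambda>w. P w * Q w"]) (use P Q in auto)
qed

text \<open>A strictly larger bound lies above the degree, so the coefficient there is zero; this
  brings summands to a common bound.\<close>

lemma line_poly_raise: "line_poly v f D a \<Longrightarrow> D < E \<Longrightarrow> line_poly v f E 0"
  unfolding line_poly_def by (metis coeff_eq_0 dual_order.trans le_less_trans less_imp_le)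

lemma line_poly_power: "line_poly v f D a \<Longrightarrow> line_poly v (\<lambda>z. f z ^ m) (m * D) (a ^ m)"
proof (induction m)
  case 0
  then show ?case using line_poly_const[of v 1] by simp
next
  case (Suc m)
  then show ?case using line_poly_mult[of v f D a "\<lambda>z. f z ^ m" "m * D" "a ^ m"] by simp
qed

lemma line_poly_monomial:
  "line_poly v (\<lambda>z. c * (\<Prod>i\<in>UNIV. (z $ i) ^ (\<alpha> i))) (\<Sum>i\<in>UNIV. \<alpha> i) (c * (\<Prod>i\<in>UNIV. (v $ i) ^ (\<alpha> i)))"
proof -
  have "line_poly v (\<lambda>z. \<Prod>i\<in>I. (z $ i) ^ (\<alpha> i)) (\<Sum>i\<in>I. \<alpha> i) (\<Prod>i\<in>I. (v $ i) ^ (\<alpha> i))"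
    if "finite I" for I
    using that
  proof (induction I)
    case empty
    then show ?case using line_poly_const[of v 1] by simp
  next
    case (insert i I)
    then show ?case using line_poly_mult[OF line_poly_power[OF line_poly_coord] insert.IH] by simp
  qed
  from line_poly_mult[OF line_poly_const this[OF finite_class.finite_UNIV]] show ?thesis by simp
qed

lemma line_poly_sum:
  assumes "\<And>x. x \<in> X \<Longrightarrow> line_poly v (f x) D (a x)"
  shows "line_poly v (\<lambda>z. \<Sum>x\<in>X. f x z) D (\<Sum>x\<in>X. a x)"
proof -
  \<comment> \<open>The empty sum; raising the bound requires a strict inequality, hence the
    separate case \<open>D = 0\<close>.\<close>
  have z: "line_poly v (\<lambda>_. 0) D 0"
    using line_poly_raise[OF line_poly_const[of v 0], of D] line_poly_const[of v 0] by (cases "D = 0") auto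
  show ?thesis using assms
    by (induction X rule: infinite_finite_induct) (auto intro!: z line_poly_add)
qed

lemma poly_fun_line_poly: "poly_fun f \<Longrightarrow> \<exists>D. line_poly v f D 0"
proof (induction rule: poly_fun_induct)
  case (const c)
  then show ?case using line_poly_raise[OF line_poly_const] by blast
next
  case (coord i)
  then show ?case using line_poly_raise[OF line_poly_coord] by blast
next
  case (add f g)
  then obtain D E where "line_poly v f D 0" "line_poly v g E 0" by blast
  then have "line_poly v f (Suc (D + E)) 0" "line_poly v g (Suc (D + E)) 0"
    by (auto elim: line_poly_raise)
  then show ?case using line_poly_add by fastforce
next
  case (mult f g)
  then show ?case using line_poly_mult by fastforce
qed

lemma poly_fun_on_line:
  assumes "poly_fun f"
  obtains p where "\<And>s. poly p s = f (w + s *s v)"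
  using poly_fun_line_poly[OF assms, of v] unfolding line_poly_def by blast

text \<open>Both restrictions to the line through \<open>x\<close> and \<open>y\<close> are nonzero
  polynomials in \<open>s\<close>, so their product is nonzero. The point found lies in every linear
  subspace that contains \<open>x\<close> and \<open>y\<close>.\<close>

lemma poly_fun_mult_nonzero:
  fixes f g :: "complex^'n::finite \<Rightarrow> complex"
  assumes "poly_fun f" "poly_fun g" "f x \<noteq> 0" "g y \<noteq> 0"
  obtains s where "f (x + s *s (y - x)) \<noteq> 0" "g (x + s *s (y - x)) \<noteq> 0"
proof -
  obtain p where p: "\<And>s. poly p s = f (x + s *s (y - x))" using poly_fun_on_line[OF assms(1), of x "y - x"] by blast
  obtain q where q: "\<And>s. poly q s = g (x + s *s (y - x))" using poly_fun_on_line[OF assms(2), of x "y - x"] by blast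
  have "p \<noteq> 0" using p[of 0] assms(3) by auto
  moreover have "q \<noteq> 0" using q[of 1] assms(4) by auto
  ultimately have "p * q \<noteq> 0" by simp
  then obtain s where "poly (p * q) s \<noteq> 0" using poly_all_0_iff_0 by blast
  then show ?thesis using that[of s] p q by simp
qed

section \<open>Homogeneous parts and the choice of the direction\<close>

text \<open>Group the monomials by total degree. On a line in direction \<open>v\<close> the
  coefficient of \<open>s ^ j\<close> in the part of degree \<open>j\<close> is the value of that
  part at \<open>v\<close>.\<close>

lemma poly_fun_homogeneous_decomposition:
  fixes f :: "complex^'n::finite \<Rightarrow> complex"
  assumes "poly_fun f"
  obtains N h where "\<And>j. poly_fun (h j)" "\<And>j c z. h j (c *s z) = c ^ j * h j z"
    "\<And>j v. line_poly v (h j) j (h j v)" "\<And>z. f z = (\<Sum>j\<le>N. h j z)"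
proof -
  from assms(1) obtain A a where A: "finite A" "\<And>z. f z = (\<Sum>\<alpha>\<in>A. a \<alpha> * (\<Prod>i\<in>UNIV. (z $ i) ^ (\<alpha> i)))"
    unfolding poly_fun_def by blast
  define dg :: "('n \<Rightarrow> nat) \<Rightarrow> nat" where "dg = (\<lambda>\<alpha>. \<Sum>i\<in>UNIV. \<alpha> i)"
  define h where "h = (\<lambda>j z. \<Sum>\<alpha>\<in>{\<alpha>\<in>A. dg \<alpha> = j}. a \<alpha> * (\<Prod>i\<in>UNIV. (z $ i) ^ (\<alpha> i)))"
  define N where "N = Max (insert 0 (dg ` A))"
  have N: "dg \<alpha> \<le> N" if "\<alpha> \<in> A" for \<alpha>
    using that A(1) by (auto simp: N_def)
  show ?thesis
  proof (rule that[of h N])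
    show "poly_fun (h j)" for j
      unfolding h_def by (intro poly_fun_sum poly_fun_monomial)
    show "h j (c *s z) = c ^ j * h j z" for j c z
      unfolding h_def sum_distrib_left
      by (intro sum.cong) (auto simp: power_mult_distrib prod.distrib power_sum dg_def)
    show "line_poly v (h j) j (h j v)" for j v
      unfolding h_def by (intro line_poly_sum) (use line_poly_monomial[of v] in \<open>auto simp: dg_def\<close>)
    show "f z = (\<Sum>j\<le>N. h j z)" for z
      unfolding A(2) h_def using N A(1)
      by (subst sum.group[of A "{..N}" dg, symmetric]) auto
  qed
qed

lemma norm_vector_scalar_mult: "norm (c *s (x :: complex^'n::finite)) = norm c * norm x"
  by (simp add: norm_vec_def norm_mult L2_set_right_distrib)

text \<open>The top nonvanishing homogeneous part \<open>h D\<close> is nonzero at \<open>v\<close>,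
  hence bounded away from zero near \<open>v\<close>. A zero of \<open>f\<close> whose coordinate
  \<open>s\<close> at \<open>i0\<close> is large compared with its base part would, after division
  by \<open>s\<close>, lie near \<open>v\<close>, where the top part outweighs all the lower
  ones.\<close>

lemma noncharacteristic_direction:
  fixes f :: "complex^'n::finite \<Rightarrow> complex"
  assumes "poly_fun f" "f z0 \<noteq> 0"
  obtains v D \<tau> K where "v $ i0 = 1" "\<tau> \<noteq> 0" "line_poly v f D \<tau>" "K > 0"
    "\<And>z. f z = 0 \<Longrightarrow> norm (z $ i0) \<le> K * (1 + norm (z - (z $ i0) *s v))"
proof (rule poly_fun_homogeneous_decomposition[OF assms(1)])
  fix N h assume h: "\<And>j. poly_fun (h j)" "\<And>j c z. h j (c *s z) = c ^ j * h j z"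
    "\<And>j v. line_poly v (h j) j (h j v)" "\<And>z. f z = (\<Sum>j\<le>N. h j z)"
  define S where "S = {j. j \<le> N \<and> (\<exists>u. h j u \<noteq> 0)}"
  have fS: "finite S" unfolding S_def by simp
  have "S \<noteq> {}"
    using assms(2) sum.not_neutral_contains_not_neutral[of "\<lambda>j. h j z0" "{..N}"]
    unfolding h(4) S_def by blast
  define D where "D = Max S"
  have DS: "D \<in> S" unfolding D_def using fS \<open>S \<noteq> {}\<close> by (rule Max_in)
  have top: "h j u = 0" if "D < j" "j \<le> N" for j u
  proof (rule ccontr)
    assume "h j u \<noteq> 0"
    then have "j \<in> S" using that by (auto simp: S_def)
    from Max_ge[OF fS this] show False using that by (simp add: D_def)
  qed
  have f: "f z = (\<Sum>j\<le>D. h j z)" for z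
    unfolding h(4) using DS top by (intro sum.mono_neutral_right) (auto simp: S_def not_le)
  obtain u where u: "h D u \<noteq> 0" using DS unfolding S_def by blast
  \<comment> \<open>Some point has both \<open>h D\<close> and the coordinate \<open>i0\<close>
    nonzero; by homogeneity it may be scaled to make that coordinate 1.\<close>
  have "(axis i0 1 :: complex^'n) $ i0 \<noteq> 0" by simp
  then obtain s where "h D (u + s *s (axis i0 1 - u)) \<noteq> 0" "(u + s *s (axis i0 1 - u)) $ i0 \<noteq> 0"
    using poly_fun_mult_nonzero[OF h(1)[of D] poly_fun_coord[of i0] u, of "axis i0 1"] by auto
  then obtain v0 where v0: "h D v0 \<noteq> 0" "v0 $ i0 \<noteq> 0" by blast
  define v where "v = (1 / v0 $ i0) *s v0"
  have v: "v $ i0 = 1" "h D v \<noteq> 0" using v0 by (auto simp: v_def h(2))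
  have lp: "line_poly v f D (h D v)"
  proof -
    have "line_poly v (h j) D (if j = D then h D v else 0)" if "j \<in> {..D}" for j
      using h(3)[of v j] line_poly_raise[OF h(3)[of v j], of D] that by auto
    from line_poly_sum[of "{..D}" v h D "\<lambda>j. if j = D then h D v else 0", OF this] have "line_poly v (\<lambda>z. \<Sum>j\<le>D. h j z) D (h D v)" by simp
    then show ?thesis using f by presburger
  qed
  have cont: "continuous_on A (h j)" for j A
    using poly_fun_continuous[OF h(1)] continuous_on_subset by blast
  define \<eta> where "\<eta> = norm (h D v) / 2"
  have "\<eta> > 0" using v by (simp add: \<eta>_def)
  obtain \<epsilon> where e: "\<epsilon> > 0" "\<And>x. dist x v < \<epsilon> \<Longrightarrow> dist (h D x) (h D v) < \<eta>"
    using cont[of UNIV D] \<open>\<eta> > 0\<close> unfolding continuous_on_iff by (metis UNIV_I)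
  have low: "norm (h D x) > \<eta>" if "dist x v < \<epsilon>" for x
  proof -
    have "norm (h D v) \<le> norm (h D x) + dist (h D x) (h D v)"
      by (simp add: dist_norm norm_minus_commute norm_triangle_sub)
    then show ?thesis using e(2)[OF that] by (simp add: \<eta>_def)
  qed
  have "\<exists>M. \<forall>x\<in>cball v \<epsilon>. norm (h j x) \<le> M" for j
    using compact_imp_bounded[OF compact_continuous_image[OF cont compact_cball]]
    by (fastforce simp: bounded_iff)
  then obtain M where M: "\<And>j x. x \<in> cball v \<epsilon> \<Longrightarrow> norm (h j x) \<le> M j" by metis
  define L where "L = (\<Sum>j<D. M j)"
  have M0: "M j \<ge> 0" for j
    using M[of v j] e(1) by (meson centre_in_cball less_imp_le norm_ge_zero order_trans)
  then have "L \<ge> 0" by (simp add: L_def sum_nonneg)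
  \<comment> \<open>Then \<open>norm s > R\<close> gives \<open>norm s * \<eta> > L\<close>, so the
    top part outweighs the sum of the lower ones; \<open>R \<ge> 1\<close> allows powers of
    \<open>norm s\<close> to be compared.\<close>
  define R where "R = 1 + L / \<eta>"
  have "R \<ge> 1" using \<open>L \<ge> 0\<close> \<open>\<eta> > 0\<close> by (simp add: R_def)
  show ?thesis
  proof (rule that[OF v(1) v(2) lp, of "R + 1 / \<epsilon>"])
    show "0 < R + 1 / \<epsilon>" using \<open>R \<ge> 1\<close> e(1) by (simp add: add_pos_pos)
    fix z assume z: "f z = 0"
    define s where "s = z $ i0"
    define w where "w = z - s *s v"
    have "norm s \<le> R \<or> norm s \<le> norm w / \<epsilon>"
    proof (rule ccontr)
      assume "\<not> ?thesis"
      then have s: "norm s > R" "norm s > norm w / \<epsilon>" by auto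
      then have s1: "norm s > 1" using \<open>R \<ge> 1\<close> by linarith
      then have s0: "s \<noteq> 0" by auto
      define x where "x = v + (1 / s) *s w"
      have zx: "z = s *s x" using s0 by (simp add: x_def w_def vec_eq_iff field_simps)
      have "dist x v = norm w / norm s"
        by (simp add: x_def dist_norm norm_vector_scalar_mult norm_divide)
      also have "\<dots> < \<epsilon>" using s(2) s0 e(1) by (simp add: pos_divide_less_eq mult.commute)
      finally have dx: "dist x v < \<epsilon>" .
      then have xc: "x \<in> cball v \<epsilon>" by (simp add: dist_commute)
      have "0 = (\<Sum>j<D. s ^ j * h j x) + s ^ D * h D x"
        using z unfolding f zx h(2) by (simp add: lessThan_Suc_atMost[symmetric])
      then have "norm (s ^ D * h D x) = norm (\<Sum>j<D. s ^ j * h j x)"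
        by (metis add.commute add_eq_0_iff norm_minus_cancel)
      \<comment> \<open>After one extra factor \<open>norm s\<close>, every lower power is still at
        most \<open>norm s ^ D\<close>, which then cancels.\<close>
      then have "norm s * (norm s ^ D * norm (h D x)) = norm (\<Sum>j<D. s * (s ^ j * h j x))"
        by (simp add: norm_mult norm_power sum_distrib_left[symmetric])
      also have "\<dots> \<le> (\<Sum>j<D. norm s ^ D * M j)"
      proof (rule sum_norm_le)
        fix j assume "j \<in> {..<D}"
        then have "norm s ^ Suc j \<le> norm s ^ D" using s1 by (intro power_increasing) auto
        then have "norm s ^ Suc j * norm (h j x) \<le> norm s ^ D * M j"
          by (intro mult_mono M[OF xc]) auto
        then show "norm (s * (s ^ j * h j x)) \<le> norm s ^ D * M j"
          by (simp add: norm_mult norm_power mult_ac)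
      qed
      also have "\<dots> = norm s ^ D * L" by (simp add: L_def sum_distrib_left)
      finally have "norm s ^ D * (norm s * norm (h D x)) \<le> norm s ^ D * L" by (simp add: mult_ac)
      then have "norm s * norm (h D x) \<le> L" using s1 s0 by simp
      moreover have "norm s * \<eta> \<le> norm s * norm (h D x)"
        using low[OF dx] by (intro mult_left_mono) auto
      moreover have "L < norm s * \<eta>"
        using s(1) \<open>\<eta> > 0\<close> unfolding R_def by (simp add: field_simps)
      ultimately show False by linarith
    qed
    moreover have "R \<le> (R + 1 / \<epsilon>) * (1 + norm w)" "norm w / \<epsilon> \<le> (R + 1 / \<epsilon>) * (1 + norm w)"
      using \<open>R \<ge> 1\<close> e(1) by (auto simp: algebra_simps intro!: add_increasing)
    ultimately show "norm (z $ i0) \<le> (R + 1 / \<epsilon>) * (1 + norm (z - (z $ i0) *s v))"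
      unfolding s_def w_def by linarith
  qed
qed

section \<open>Chains of irreducible sets\<close>

lemma algebraic_set_Inter:
  assumes "\<And>X. X \<in> \<X> \<Longrightarrow> algebraic_set (X :: (complex^'n::finite) set)"
  shows "algebraic_set (\<Inter>\<X>)"
proof -
  have "\<forall>X\<in>\<X>. \<exists>P. (\<forall>f\<in>P. poly_fun f) \<and> X = {z. \<forall>f\<in>P. f z = 0}"
    using assms unfolding algebraic_set_def by blast
  from bchoice[OF this] obtain P where
    P: "\<forall>X\<in>\<X>. (\<forall>f\<in>P X. poly_fun f) \<and> X = {z. \<forall>f\<in>P X. f z = 0}" ..
  have "z \<in> \<Inter>\<X> \<longleftrightarrow> (\<forall>f\<in>(\<Union>X\<in>\<X>. P X). f z = 0)" for z
  proof -
    have "z \<in> X \<longleftrightarrow> (\<forall>f\<in>P X. f z = 0)" if "X \<in> \<X>" for X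
      using P that by blast
    then show ?thesis by auto
  qed
  then have "\<Inter>\<X> = {z. \<forall>f\<in>(\<Union>X\<in>\<X>. P X). f z = 0}" by blast
  moreover have "\<forall>f\<in>(\<Union>X\<in>\<X>. P X). poly_fun f" using P by blast
  ultimately show ?thesis unfolding algebraic_set_def by blast
qed

lemma algebraic_set_zeros: "poly_fun f \<Longrightarrow> algebraic_set {z. f z = 0}"
  unfolding algebraic_set_def by (rule exI[of _ "{f}"]) auto

lemma algebraic_set_inter: "algebraic_set X \<Longrightarrow> algebraic_set Y \<Longrightarrow> algebraic_set (X \<inter> Y)"
  using algebraic_set_Inter[of "{X, Y}"] by auto

lemma algebraic_set_separate:
  assumes "algebraic_set X" "z \<notin> X"
  obtains g where "poly_fun g" "\<And>x. x \<in> X \<Longrightarrow> g x = 0" "g z \<noteq> 0"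
  using assms unfolding algebraic_set_def by auto

text \<open>The zero sets of \<open>f\<close> and \<open>g\<close> cut \<open>X\<close> into two
  algebraic pieces, so one of them is all of \<open>X\<close>: polynomial functions on an
  irreducible set form an integral domain.\<close>

lemma irreducible_alg_mult:
  assumes "irreducible_alg X" "poly_fun f" "poly_fun g" "\<And>z. z \<in> X \<Longrightarrow> f z * g z = 0" "y \<in> X" "f y \<noteq> 0"
    and "z \<in> X"
  shows "g z = 0"
proof -
  have "algebraic_set (X \<inter> {z. f z = 0})" "algebraic_set (X \<inter> {z. g z = 0})"
    using assms by (auto intro!: algebraic_set_inter algebraic_set_zeros simp: irreducible_alg_def)
  moreover have "X = X \<inter> {z. f z = 0} \<union> X \<inter> {z. g z = 0}"
    using assms(4) by auto
  ultimately have "X = X \<inter> {z. f z = 0} \<or> X = X \<inter> {z. g z = 0}"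
    using assms(1) unfolding irreducible_alg_def by blast
  then show ?thesis using assms(5-7) by blast
qed

text \<open>Descend along the chain. Sort a relation on \<open>C (Suc n)\<close> by powers of
  \<open>g n\<close> and divide by the lowest power that occurs, which irreducibility permits.
  Restricting to \<open>C n\<close>, where \<open>g n\<close> vanishes, leaves a relation among the
  remaining functions.\<close>

lemma irreducible_chain_monomials_independent:
  fixes C :: "nat \<Rightarrow> (complex^'n::finite) set"
  assumes irr: "\<And>i. i \<le> n \<Longrightarrow> irreducible_alg (C i)"
    and g: "\<And>i. i < n \<Longrightarrow> poly_fun (g i)" "\<And>i z. i < n \<Longrightarrow> z \<in> C i \<Longrightarrow> g i z = 0"
      "\<And>i. i < n \<Longrightarrow> \<exists>z\<in>C (Suc i). g i z \<noteq> 0"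
    and sub: "\<And>i. i < n \<Longrightarrow> C i \<subseteq> C (Suc i)"
    and rel: "\<And>z. z \<in> C n \<Longrightarrow> (\<Sum>\<beta>\<in>PiE {..<n} (\<lambda>_. {..<N}). a \<beta> * (\<Prod>i<n. g i z ^ \<beta> i)) = 0"
    and "\<beta> \<in> PiE {..<n} (\<lambda>_. {..<N::nat})"
  shows "a \<beta> = 0"
  using assms
proof (induction n arbitrary: a \<beta>)
  case 0
  then have "C 0 \<noteq> {}" by (auto simp: irreducible_alg_def)
  then show ?case using 0 by auto
next
  case (Suc n)
  define E where "E = PiE {..<n} (\<lambda>_. {..<N})"
  \<comment> \<open>The coefficient of \<open>g n ^ j\<close> in the relation.\<close>
  define Q where "Q = (\<lambda>j z. \<Sum>\<beta>\<in>E. a (\<beta>(n := j)) * (\<Prod>i<n. g i z ^ \<beta> i))"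
  have E': "PiE {..<Suc n} (\<lambda>_. {..<N}) = (\<lambda>(j, \<beta>). \<beta>(n := j)) ` ({..<N} \<times> E)"
    unfolding E_def lessThan_Suc PiE_insert_eq by simp
  have inj: "inj_on (\<lambda>(j, \<beta>). \<beta>(n := j)) ({..<N} \<times> E)"
    unfolding E_def using inj_combinator[of n "{..<n}" "\<lambda>_. {..<N}"] by simp
  have pQ: "poly_fun (Q j)" for j
    unfolding Q_def by (intro poly_fun_sum poly_fun_mult poly_fun_prod poly_fun_power poly_fun_const) (use Suc.prems(2) in auto)
  have split: "(\<Sum>\<beta>\<in>PiE {..<Suc n} (\<lambda>_. {..<N}). a \<beta> * (\<Prod>i<Suc n. g i z ^ \<beta> i)) =
      (\<Sum>j<N. g n z ^ j * Q j z)" for z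
  proof -
    have "(\<Sum>\<beta>\<in>PiE {..<Suc n} (\<lambda>_. {..<N}). a \<beta> * (\<Prod>i<Suc n. g i z ^ \<beta> i)) =
       (\<Sum>(j, \<beta>)\<in>{..<N} \<times> E. a (\<beta>(n := j)) * (\<Prod>i<Suc n. g i z ^ (\<beta>(n := j)) i))"
      unfolding E' by (subst sum.reindex[OF inj]) (auto intro!: sum.cong)
    also have "\<dots> = (\<Sum>j<N. \<Sum>\<beta>\<in>E. a (\<beta>(n := j)) * ((\<Prod>i<n. g i z ^ \<beta> i) * g n z ^ j))"
      unfolding sum.cartesian_product[symmetric] by simp
    also have "\<dots> = (\<Sum>j<N. g n z ^ j * Q j z)"
      unfolding Q_def sum_distrib_left by (simp add: mult_ac)
    finally show ?thesis .
  qed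
  \<comment> \<open>Strong induction on the exponent of \<open>g n\<close>: lower coefficients
    already vanish, so \<open>g n ^ m\<close> divides the relation.\<close>
  have zero: "\<forall>\<beta>\<in>E. a (\<beta>(n := j)) = 0" if "j < N" for j
    using that
  proof (induction j rule: less_induct)
    case (less m)
    have Q0: "Q j z = 0" if "j < m" for j z
    proof -
      have "\<forall>\<beta>\<in>E. a (\<beta>(n := j)) = 0" using less.IH[OF that] less.prems that by linarith
      then show ?thesis unfolding Q_def by (intro sum.neutral ballI) (metis mult_zero_left)
    qed
    obtain y where y: "y \<in> C (Suc n)" "g n y \<noteq> 0" using Suc.prems(4)[of n] by blast
    define H where "H = (\<lambda>z. \<Sum>j\<in>{m..<N}. g n z ^ (j - m) * Q j z)"
    have pH: "poly_fun H" unfolding H_def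
      by (intro poly_fun_sum poly_fun_mult poly_fun_power pQ) (use Suc.prems(2) in auto)
    have prodz: "g n z ^ m * H z = 0" if "z \<in> C (Suc n)" for z
    proof -
      have "g n z ^ m * H z = (\<Sum>j\<in>{m..<N}. g n z ^ j * Q j z)"
        unfolding H_def sum_distrib_left
        by (intro sum.cong) (auto simp: power_add[symmetric] mult.assoc[symmetric])
      also have "\<dots> = (\<Sum>j<N. g n z ^ j * Q j z)"
        by (intro sum.mono_neutral_left) (auto simp: Q0)
      also have "\<dots> = 0" using Suc.prems(6)[OF that] unfolding split .
      finally show ?thesis .
    qed
    have "H z = 0" if "z \<in> C (Suc n)" for z
      by (rule irreducible_alg_mult[of "C (Suc n)" "\<lambda>z. g n z ^ m" H y])
        (use Suc.prems(1,2) pH prodz y that in \<open>auto intro: poly_fun_power\<close>)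
    \<comment> \<open>On \<open>C n\<close> only the term \<open>j = m\<close> survives, since
      \<open>g n\<close> is zero there and \<open>0 ^ 0 = 1\<close>.\<close>
    moreover have "H z = Q m z" if "z \<in> C n" for z
    proof -
      have "H z = (\<Sum>j\<in>{m..<N}. if j = m then Q m z else 0)"
        unfolding H_def using Suc.prems(3)[OF lessI that] by (intro sum.cong) auto
      then show ?thesis using less.prems by simp
    qed
    ultimately have Qm: "Q m z = 0" if "z \<in> C n" for z
      using that Suc.prems(5)[OF lessI] by (metis subsetD)
    show ?case
    proof
      fix \<beta> assume \<beta>: "\<beta> \<in> E"
      show "a (\<beta>(n := m)) = 0"
      proof (rule Suc.IH[where a = "\<lambda>\<beta>. a (\<beta>(n := m))" and \<beta> = \<beta>])
        show "(\<Sum>\<beta>\<in>PiE {..<n} (\<lambda>_. {..<N}). a (\<beta>(n := m)) * (\<Prod>i<n. g i z ^ \<beta> i)) = 0"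
          if "z \<in> C n" for z
          using Qm[OF that] unfolding Q_def E_def .
        show "\<beta> \<in> PiE {..<n} (\<lambda>_. {..<N})" using \<beta> unfolding E_def .
        show "irreducible_alg (C i)" if "i \<le> n" for i by (rule Suc.prems(1)[OF le_SucI[OF that]])
        show "poly_fun (g i)" if "i < n" for i by (rule Suc.prems(2)[OF less_SucI[OF that]])
        show "g i z = 0" if "i < n" "z \<in> C i" for i z by (rule Suc.prems(3)[OF less_SucI[OF that(1)] that(2)])
        show "\<exists>z\<in>C (Suc i). g i z \<noteq> 0" if "i < n" for i by (rule Suc.prems(4)[OF less_SucI[OF that]])
        show "C i \<subseteq> C (Suc i)" if "i < n" for i by (rule Suc.prems(5)[OF less_SucI[OF that]])
      qed
    qed
  qed
  from Suc.prems(7) obtain j \<beta>' where "j < N" "\<beta>' \<in> E" "\<beta> = \<beta>'(n := j)"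
    unfolding E' by auto
  then show ?case using zero by blast
qed

section \<open>Counting monomials of bounded degree\<close>

definition monomial_fun :: "('n \<Rightarrow> nat) \<Rightarrow> complex^'n::finite \<Rightarrow> complex" where
  "monomial_fun \<alpha> z = (\<Prod>i\<in>UNIV. (z $ i) ^ (\<alpha> i))"

text \<open>Each exponent is bounded separately, not the total degree: the exponent vectors form a
  box that is counted at once, and bounds add under multiplication.\<close>

definition bounded_monomials :: "nat \<Rightarrow> (complex^'n::finite \<Rightarrow> complex) set" where
  "bounded_monomials D = monomial_fun ` {\<alpha>. \<forall>i. \<alpha> i \<le> D}"

text \<open>Makes the exchange bound for independent sets in a finite span available for
  functions.\<close>

interpretation fun_space: vector_space "\<lambda>(c::complex) (f :: complex^'n::finite \<Rightarrow> complex) z. c * f z"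
  by unfold_locales (auto simp: fun_eq_iff algebra_simps)

lemma card_bounded_monomials:
  "finite (bounded_monomials D :: (complex^'n::finite \<Rightarrow> complex) set)"
  "card (bounded_monomials D :: (complex^'n::finite \<Rightarrow> complex) set) \<le> Suc D ^ CARD('n)"
proof -
  have eq: "{\<alpha>::'n \<Rightarrow> nat. \<forall>i. \<alpha> i \<le> D} = PiE UNIV (\<lambda>_. {..D})" by (auto simp: PiE_def)
  have fin: "finite {\<alpha>::'n \<Rightarrow> nat. \<forall>i. \<alpha> i \<le> D}" unfolding eq by (rule finite_PiE) auto
  then show "finite (bounded_monomials D :: (complex^'n \<Rightarrow> complex) set)"
    unfolding bounded_monomials_def by (rule finite_imageI)
  have "card {\<alpha>::'n \<Rightarrow> nat. \<forall>i. \<alpha> i \<le> D} = Suc D ^ CARD('n)"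
    unfolding eq by (simp add: card_PiE)
  then show "card (bounded_monomials D :: (complex^'n \<Rightarrow> complex) set) \<le> Suc D ^ CARD('n)"
    unfolding bounded_monomials_def using card_image_le[OF fin] by metis
qed

lemma bounded_monomials_mono: "D \<le> E \<Longrightarrow> bounded_monomials D \<subseteq> bounded_monomials E"
  unfolding bounded_monomials_def by (rule image_mono) (auto intro: order_trans)

lemma span_bounded_monomials_mono:
  "f \<in> fun_space.span (bounded_monomials D) \<Longrightarrow> D \<le> E \<Longrightarrow> f \<in> fun_space.span (bounded_monomials E)"
  by (rule subsetD[OF fun_space.span_mono[OF bounded_monomials_mono]])

lemma span_bounded_monomials_mult:
  assumes "f \<in> fun_space.span (bounded_monomials D)" "g \<in> fun_space.span (bounded_monomials E)"
  shows "(\<lambda>z. f z * g z) \<in> fun_space.span (bounded_monomials (D + E))"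
proof -
  let ?S = "fun_space.span (bounded_monomials (D + E))"
  have mono: "(\<lambda>z. m z * g z) \<in> ?S" if m: "m \<in> bounded_monomials D" for m
    using assms(2)
  proof (induction rule: fun_space.span_induct_alt)
    case base
    then show ?case using fun_space.span_zero by (simp add: zero_fun_def)
  next
    case (step c e y)
    then obtain \<alpha> \<beta> where ab: "m = monomial_fun \<alpha>" "\<forall>i. \<alpha> i \<le> D" "e = monomial_fun \<beta>" "\<forall>i. \<beta> i \<le> E"
      using m unfolding bounded_monomials_def by blast
    have "(\<lambda>z. m z * e z) = monomial_fun (\<lambda>i. \<alpha> i + \<beta> i)"
      by (simp add: ab monomial_fun_def fun_eq_iff power_add prod.distrib)
    moreover have "monomial_fun (\<lambda>i. \<alpha> i + \<beta> i) \<in> bounded_monomials (D + E)"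
      unfolding bounded_monomials_def using ab by (intro imageI) (auto intro: add_mono)
    ultimately have "(\<lambda>z. m z * e z) \<in> ?S" using fun_space.span_base by metis
    from fun_space.span_add[OF fun_space.span_scale[OF this, of c] step(2)]
    show ?case by (simp add: plus_fun_def algebra_simps)
  qed
  show ?thesis using assms(1)
  proof (induction rule: fun_space.span_induct_alt)
    case base
    then show ?case using fun_space.span_zero by (simp add: zero_fun_def)
  next
    case (step c m y)
    from fun_space.span_add[OF fun_space.span_scale[OF mono[OF step(1)], of c] step(2)]
    show ?case by (simp add: plus_fun_def algebra_simps)
  qed
qed

lemma poly_fun_span_bounded_monomials:
  "poly_fun f \<Longrightarrow> \<exists>D. f \<in> fun_space.span (bounded_monomials D)"
proof (induction rule: poly_fun_induct)
  case (const c)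
  have "monomial_fun (\<lambda>_. 0) \<in> bounded_monomials 0" unfolding bounded_monomials_def by auto
  from fun_space.span_scale[OF fun_space.span_base[OF this], of c]
  show ?case by (auto simp: monomial_fun_def)
next
  case (coord i)
  have "monomial_fun (\<lambda>j. if j = i then 1 else 0) \<in> bounded_monomials 1"
    unfolding bounded_monomials_def by auto
  moreover have "monomial_fun (\<lambda>j. if j = i then 1 else 0) = (\<lambda>z. z $ i)"
    using prod.delta[of UNIV i]
    by (simp add: monomial_fun_def fun_eq_iff if_distrib[of "\<lambda>m. _ ^ m"] cong: if_cong)
  ultimately show ?case using fun_space.span_base by metis
next
  case (add f g)
  then obtain D E where "f \<in> fun_space.span (bounded_monomials D)" "g \<in> fun_space.span (bounded_monomials E)"
    by blast
  then have "f \<in> fun_space.span (bounded_monomials (max D E))" "g \<in> fun_space.span (bounded_monomials (max D E))"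
    by (auto elim: span_bounded_monomials_mono)
  from fun_space.span_add[OF this] show ?case by (auto simp: plus_fun_def)
next
  case (mult f g)
  then show ?case using span_bounded_monomials_mult by blast
qed

lemma span_bounded_monomials_power:
  assumes "f \<in> fun_space.span (bounded_monomials D)"
  shows "(\<lambda>z. f z ^ m) \<in> fun_space.span (bounded_monomials (m * D))"
proof (induction m)
  case 0
  have "monomial_fun (\<lambda>_. 0) \<in> bounded_monomials 0" unfolding bounded_monomials_def by auto
  from fun_space.span_base[OF this] show ?case by (simp add: monomial_fun_def[abs_def])
next
  case (Suc m)
  then show ?case using span_bounded_monomials_mult[OF assms] by simp
qed

lemma span_bounded_monomials_prod_power:
  assumes "\<And>i. i < n \<Longrightarrow> g i \<in> fun_space.span (bounded_monomials D)" "\<And>i. i < n \<Longrightarrow> \<beta> i \<le> N"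
  shows "(\<lambda>z. \<Prod>i<n. g i z ^ \<beta> i) \<in> fun_space.span (bounded_monomials (n * (N * D)))"
  using assms
proof (induction n)
  case 0
  have "monomial_fun (\<lambda>_. 0) \<in> bounded_monomials 0" unfolding bounded_monomials_def by auto
  from fun_space.span_base[OF this] show ?case by (simp add: monomial_fun_def[abs_def])
next
  case (Suc n)
  have "\<beta> n * D \<le> N * D" using Suc.prems(2)[of n] by simp
  then have "(\<lambda>z. g n z ^ \<beta> n) \<in> fun_space.span (bounded_monomials (N * D))"
    by (rule span_bounded_monomials_mono[OF span_bounded_monomials_power[OF Suc.prems(1)[OF lessI]]])
  from span_bounded_monomials_mult[OF Suc.IH this] Suc.prems show ?case
    by (simp add: add.commute)
qed

text \<open>Count dimensions. From \<open>k + 1\<close> steps one gets \<open>N ^ (k + 1)\<close>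
  independent products with exponents below \<open>N\<close>, yet all lie in the span of at most
  \<open>(Suc k * N * D + 1) ^ k\<close> monomials, which grows only like
  \<open>N ^ k\<close>.\<close>

lemma irreducible_chain_length:
  fixes C :: "nat \<Rightarrow> (complex^'n::finite) set"
  assumes irr: "\<And>i. i \<le> n \<Longrightarrow> irreducible_alg (C i)" and sub: "\<And>i. i < n \<Longrightarrow> C i \<subset> C (Suc i)"
  shows "n \<le> CARD('n)"
proof (rule ccontr)
  define k where "k = CARD('n)"
  assume "\<not> n \<le> CARD('n)"
  then have kn: "Suc k \<le> n" by (simp add: k_def)
  have "\<exists>g. poly_fun g \<and> (\<forall>z\<in>C i. g z = 0) \<and> (\<exists>z\<in>C (Suc i). g z \<noteq> 0)" if i: "i < Suc k" for i
  proof -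
    obtain z where z: "z \<in> C (Suc i)" "z \<notin> C i" using sub[of i] i kn by (meson less_le_trans psubsetE subsetI)
    have "algebraic_set (C i)" using irr[of i] i kn by (simp add: irreducible_alg_def)
    from algebraic_set_separate[OF this z(2)] show ?thesis using z(1) by metis
  qed
  then obtain g where g: "\<And>i. i < Suc k \<Longrightarrow> poly_fun (g i)" "\<And>i z. i < Suc k \<Longrightarrow> z \<in> C i \<Longrightarrow> g i z = 0"
      "\<And>i. i < Suc k \<Longrightarrow> \<exists>z\<in>C (Suc i). g i z \<noteq> 0"
    by metis
  have "\<forall>i. \<exists>D. i < Suc k \<longrightarrow> g i \<in> fun_space.span (bounded_monomials D)"
    using poly_fun_span_bounded_monomials g(1) by blast
  then obtain Dg where Dg: "\<And>i. i < Suc k \<Longrightarrow> g i \<in> fun_space.span (bounded_monomials (Dg i))"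
    by metis
  define D where "D = (\<Sum>i<Suc k. Dg i)"
  have gD: "g i \<in> fun_space.span (bounded_monomials D)" if "i < Suc k" for i
  proof -
    have "Dg i \<le> D" unfolding D_def using that by (intro member_le_sum) auto
    then show ?thesis by (rule span_bounded_monomials_mono[OF Dg[OF that]])
  qed
  \<comment> \<open>Large enough to exceed \<open>(Suc k * D + 1) ^ k\<close>, the constant
    multiplying \<open>N ^ k\<close> in the count of monomials.\<close>
  define N where "N = Suc ((Suc k * D + 1) ^ k)"
  define E where "E = PiE {..<Suc k} (\<lambda>_. {..<N})"
  define M where "M = (\<lambda>(\<beta> :: nat \<Rightarrow> nat) z. \<Prod>i<Suc k. g i z ^ \<beta> i)"
  have fE: "finite E" unfolding E_def by (auto intro: finite_PiE)
  have indep: "a \<beta> = 0" if rel: "\<And>z. (\<Sum>\<beta>\<in>E. a \<beta> * M \<beta> z) = 0" and \<beta>: "\<beta> \<in> E" for a \<beta>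
  proof (rule irreducible_chain_monomials_independent[where n = "Suc k" and C = C and g = g and N = N and a = a and \<beta> = \<beta>])
    show "irreducible_alg (C i)" if "i \<le> Suc k" for i using that kn irr by simp
    show "C i \<subseteq> C (Suc i)" if "i < Suc k" for i using that kn sub[of i] by auto
    show "(\<Sum>\<beta>\<in>PiE {..<Suc k} (\<lambda>_. {..<N}). a \<beta> * (\<Prod>i<Suc k. g i z ^ \<beta> i)) = 0" for z
      using rel[of z] unfolding E_def M_def .
    show "\<beta> \<in> PiE {..<Suc k} (\<lambda>_. {..<N})" using \<beta> unfolding E_def .
  qed (use g in auto)
  \<comment> \<open>The dimension bound is about sets of functions, so different exponents must give
    different products; an equality would be a relation with coefficients 1 and -1.\<close>
  have inj: "inj_on M E"
  proof (rule inj_onI, rule ccontr)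
    fix \<beta> \<gamma> assume *: "\<beta> \<in> E" "\<gamma> \<in> E" "M \<beta> = M \<gamma>" "\<beta> \<noteq> \<gamma>"
    define a :: "(nat \<Rightarrow> nat) \<Rightarrow> complex" where "a = (\<lambda>\<mu>. (if \<mu> = \<beta> then 1 else 0) - (if \<mu> = \<gamma> then 1 else 0))"
    have "(\<Sum>\<mu>\<in>E. a \<mu> * M \<mu> z) = M \<beta> z - M \<gamma> z" for z
      using fE *(1,2) by (simp add: a_def left_diff_distrib sum_subtractf if_distrib[of "\<lambda>c. c * _"] cong: if_cong)
    then have "a \<beta> = 0" using indep[OF _ *(1), of a] *(3) by simp
    then show False using *(4) by (simp add: a_def)
  qed
  have "fun_space.independent (M ` E)"
    unfolding fun_space.dependent_finite[OF finite_imageI[OF fE]]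
  proof
    assume "\<exists>u. (\<exists>v\<in>M ` E. u v \<noteq> 0) \<and> (\<Sum>v\<in>M ` E. (\<lambda>z. u v * v z)) = 0"
    then obtain u \<beta> where u: "\<beta> \<in> E" "u (M \<beta>) \<noteq> 0" "(\<Sum>v\<in>M ` E. (\<lambda>z. u v * v z)) = 0" by blast
    have "(\<Sum>\<mu>\<in>E. u (M \<mu>) * M \<mu> z) = 0" for z
    proof -
      have "(\<Sum>v\<in>M ` E. (\<lambda>z. u v * v z)) z = (\<Sum>v\<in>M ` E. u v * v z)"
        by (induction rule: finite_induct[OF finite_imageI[OF fE, of M]]) auto
      also have "\<dots> = (\<Sum>\<mu>\<in>E. u (M \<mu>) * M \<mu> z)" by (simp add: sum.reindex[OF inj])
      finally show ?thesis using u(3) by simp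
    qed
    from indep[OF this u(1)] show False using u(2) by simp
  qed
  moreover have "M ` E \<subseteq> fun_space.span (bounded_monomials (Suc k * (N * D)))"
  proof
    fix m assume "m \<in> M ` E"
    then obtain \<beta> where "\<beta> \<in> E" "m = M \<beta>" by blast
    moreover from this have "\<beta> i \<le> N" if "i < Suc k" for i using that unfolding E_def by (auto simp: PiE_iff less_imp_le)
    ultimately show "m \<in> fun_space.span (bounded_monomials (Suc k * (N * D)))"
      unfolding M_def using span_bounded_monomials_prod_power[of "Suc k" g D \<beta> N] gD by simp
  qed
  ultimately have "card (M ` E) \<le> card (bounded_monomials (Suc k * (N * D)) :: (complex^'n \<Rightarrow> complex) set)"
    using fun_space.independent_span_bound[OF card_bounded_monomials(1)] by blast
  also have "\<dots> \<le> Suc (Suc k * (N * D)) ^ k" unfolding k_def by (rule card_bounded_monomials)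
  also have "\<dots> \<le> (N * (Suc k * D + 1)) ^ k"
    by (intro power_mono) (simp_all add: N_def algebra_simps)
  also have "\<dots> < N ^ k * N"
    unfolding power_mult_distrib by (rule mult_strict_left_mono) (simp_all add: N_def)
  finally have "card (M ` E) < N ^ Suc k" by (simp add: mult.commute)
  moreover have "card (M ` E) = N ^ Suc k"
    using card_image[OF inj] by (simp add: E_def card_PiE)
  ultimately show False by simp
qed

section \<open>Projections along a line\<close>

text \<open>For \<open>v $ i0 = 1\<close> this is the linear projection along \<open>v\<close> onto
  the hyperplane \<open>z $ i0 = 0\<close>, and \<open>z $ i0\<close> is the parameter of
  \<open>z\<close> on its fibre.\<close>

definition line_proj :: "complex^'n::finite \<Rightarrow> 'n \<Rightarrow> complex^'n \<Rightarrow> complex^'n" where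
  "line_proj v i0 z = z - (z $ i0) *s v"

lemma poly_fun_line_proj: "poly_fun h \<Longrightarrow> poly_fun (\<lambda>z. h (line_proj v i0 z))"
  by (rule poly_fun_compose) (auto simp: line_proj_def intro!: poly_fun_diff poly_fun_mult)

lemma poly_fun_poly_coord: "poly_fun (\<lambda>z::complex^'n::finite. poly q (z $ i))"
  by (induction q) (auto intro!: poly_fun_add poly_fun_mult)

lemma line_proj_on_line:
  "v $ i0 = 1 \<Longrightarrow> p $ i0 = 0 \<Longrightarrow> line_proj v i0 (p + s *s v) = p"
  by (simp add: line_proj_def vec_eq_iff)

lemma line_proj_add: "line_proj v i0 z + (z $ i0) *s v = z"
  by (simp add: line_proj_def)

section \<open>Zariski closedness of the projection\<close>

text \<open>A Nullstellensatz on one line. Restricting the polynomials that vanish on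
  \<open>B\<close> gives an ideal in one variable. A nonconstant generator would have a root by the
  fundamental theorem of algebra, and there every such polynomial would vanish, putting a point of
  the line into the algebraic set \<open>B\<close>.\<close>

lemma line_ideal_one:
  assumes v: "v $ i0 = 1" "p $ i0 = 0"
    and B: "algebraic_set B" "poly_fun f" "\<And>z. z \<in> B \<Longrightarrow> f z = 0"
    and f: "f (p + s0 *s v) \<noteq> 0"
    and disj: "\<And>s. p + s *s v \<notin> B"
  obtains g where "poly_fun g" "\<And>z. z \<in> B \<Longrightarrow> g z = 0" "\<And>s. g (p + s *s v) = 1"
proof -
  define I where "I = {q. \<exists>g. poly_fun g \<and> (\<forall>z\<in>B. g z = 0) \<and> (\<forall>s. poly q s = g (p + s *s v))}"
  obtain q0 where "\<And>s. poly q0 s = f (p + s *s v)"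
    using poly_fun_on_line[OF B(2), of p v] by blast
  \<comment> \<open>\<open>f\<close> provides a nonzero member, so a generator can be taken of least
    degree.\<close>
  then have "q0 \<in> I \<and> q0 \<noteq> 0" unfolding I_def using B f by auto
  then obtain q where q: "q \<in> I" "q \<noteq> 0" and qmin: "\<And>r. r \<in> I \<Longrightarrow> r \<noteq> 0 \<Longrightarrow> degree q \<le> degree r"
    using ex_has_least_nat[of "\<lambda>q. q \<in> I \<and> q \<noteq> 0" q0 degree] by blast
  obtain g where g: "poly_fun g" "\<And>z. z \<in> B \<Longrightarrow> g z = 0" "\<And>s. poly q s = g (p + s *s v)"
    using q(1) unfolding I_def by blast
  have dvd: "q dvd r" if r: "r \<in> I" for r
  proof -
    obtain h where h: "poly_fun h" "\<And>z. z \<in> B \<Longrightarrow> h z = 0" "\<And>s. poly r s = h (p + s *s v)"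
      using r unfolding I_def by blast
    \<comment> \<open>The quotient is lifted to the whole space as a polynomial in
      \<open>z $ i0\<close>, which equals \<open>s\<close> on the line because
      \<open>p $ i0 = 0\<close> and \<open>v $ i0 = 1\<close>.\<close>
    have "r mod q \<in> I" unfolding I_def
    proof (intro CollectI exI conjI ballI allI)
      show "poly_fun (\<lambda>z. h z - poly (r div q) (z $ i0) * g z)"
        by (intro poly_fun_diff poly_fun_mult h g poly_fun_poly_coord)
      show "h z - poly (r div q) (z $ i0) * g z = 0" if "z \<in> B" for z
        using that by (simp add: h g)
      show "poly (r mod q) s = h (p + s *s v) - poly (r div q) ((p + s *s v) $ i0) * g (p + s *s v)" for s
        using v by (simp add: minus_div_mult_eq_mod[symmetric] h g)
    qed
    then have "r mod q = 0"
      using qmin[of "r mod q"] degree_mod_less'[of q r] q(2) by force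
    then show ?thesis by auto
  qed
  have "degree q = 0"
  proof (rule ccontr)
    assume "degree q \<noteq> 0"
    then obtain s where s: "poly q s = 0"
      using fundamental_theorem_of_algebra[of q] by (auto simp: constant_degree)
    obtain h where h: "poly_fun h" "\<And>x. x \<in> B \<Longrightarrow> h x = 0" "h (p + s *s v) \<noteq> 0"
      using algebraic_set_separate[OF B(1) disj[of s]] by blast
    obtain r where r: "\<And>s. poly r s = h (p + s *s v)"
      using poly_fun_on_line[OF h(1), of p v] by blast
    have "r \<in> I" unfolding I_def using h r by blast
    from dvd[OF this] s have "poly r s = 0" by (auto simp: dvd_def)
    then show False using r h(3) by simp
  qed
  then obtain c where c: "q = [:c:]" by (rule degree_eq_zeroE)
  show ?thesis
  proof (rule that)
    show "poly_fun (\<lambda>z. (1 / c) * g z)" by (intro poly_fun_mult g poly_fun_const)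
    show "(1 / c) * g z = 0" if "z \<in> B" for z using g that by simp
    show "(1 / c) * g (p + s *s v) = 1" for s using g(3)[of s] q(2) c by auto
  qed
qed

text \<open>Long division by \<open>P w\<close>, uniformly in \<open>w\<close>: the coefficient at
  \<open>D\<close> is the nonzero constant \<open>\<tau>\<close>, so no denominator depends on
  \<open>w\<close> and the remainder stays polynomial in \<open>w\<close>.\<close>

lemma poly_family_division:
  fixes P G :: "complex^'n::finite \<Rightarrow> complex poly"
  assumes P: "\<And>l. poly_fun (\<lambda>w. coeff (P w) l)" "\<And>w. degree (P w) \<le> D" "\<And>w. coeff (P w) D = \<tau>" "\<tau> \<noteq> 0"
    and "\<And>l. poly_fun (\<lambda>w. coeff (G w) l)" "\<And>w l. l \<ge> m \<Longrightarrow> coeff (G w) l = 0"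
  shows "\<exists>T. (\<forall>l. poly_fun (\<lambda>w. coeff (T w) l)) \<and> (\<forall>w l. l \<ge> D \<longrightarrow> coeff (T w) l = 0) \<and>
     (\<forall>w. P w dvd G w - T w)"
  using assms(5,6)
proof (induction m arbitrary: G)
  case 0
  then show ?case by (intro exI[of _ G]) auto
next
  case (Suc m)
  show ?case
  proof (cases "Suc m \<le> D")
    case True
    then show ?thesis using Suc.prems by (intro exI[of _ G]) auto
  next
    case False
    define \<kappa> where "\<kappa> = 1 / \<tau>"
    \<comment> \<open>Cancels the coefficient at \<open>m\<close>, lowering the bound by
      one.\<close>
    define G' where "G' = (\<lambda>w. G w - monom (coeff (G w) m / \<tau>) (m - D) * P w)"
    have coeffG': "coeff (G' w) l = coeff (G w) l -
        (if l < m - D then 0 else \<kappa> * coeff (G w) m * coeff (P w) (l - (m - D)))" for w l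
      by (simp add: G'_def coeff_monom_mult \<kappa>_def)
    have "poly_fun (\<lambda>w. coeff (G' w) l)" for l
      unfolding coeffG' by (cases "l < m - D") (auto intro!: poly_fun_diff poly_fun_mult Suc.prems P)
    moreover have "coeff (G' w) l = 0" if "m \<le> l" for w l
    proof (cases "l = m")
      case True
      then show ?thesis using False P(3,4) by (simp add: coeffG' \<kappa>_def)
    next
      case neq: False
      then have "degree (P w) < l - (m - D)"
        using P(2)[of w] that False by linarith
      then show ?thesis using neq that Suc.prems(2)[of l w] by (simp add: coeffG' coeff_eq_0)
    qed
    ultimately obtain T where T: "\<And>l. poly_fun (\<lambda>w. coeff (T w) l)"
      "\<And>w l. l \<ge> D \<Longrightarrow> coeff (T w) l = 0" "\<And>w. P w dvd G' w - T w"
      using Suc.IH[of G'] by blast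
    have "P w dvd G w - T w" for w
    proof -
      have "G w - T w = (G' w - T w) + monom (coeff (G w) m / \<tau>) (m - D) * P w"
        by (simp add: G'_def)
      then show ?thesis using T(3) by (metis dvd_add dvd_triv_right)
    qed
    then show ?thesis using T by blast
  qed
qed

text \<open>A determinant-free substitute for Cramer's rule: clearing the last column by cross-multiplication keeps
  the coefficient matrix equal to the identity at \<open>p\<close>.\<close>
lemma elimination:
  fixes T :: "nat \<Rightarrow> nat \<Rightarrow> complex^'n::finite \<Rightarrow> complex"
  assumes "\<And>i j. poly_fun (T i j)"
    and "\<And>i j. i < Suc D \<Longrightarrow> j < Suc D \<Longrightarrow> T i j p = (if i = j then 1 else 0)"
  shows "\<exists>h. poly_fun h \<and> h p = 1 \<and>
    (\<forall>w x. (\<forall>i<Suc D. (\<Sum>j<Suc D. T i j w * x j) = 0) \<longrightarrow> h w * x 0 = 0)"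
  using assms
proof (induction D arbitrary: T)
  case 0
  then show ?case by (intro exI[of _ "T 0 0"]) auto
next
  case (Suc D)
  let ?e = "Suc D"
  define T' where "T' = (\<lambda>i j w. T ?e ?e w * T i j w - T i ?e w * T ?e j w)"
  have "poly_fun (T' i j)" for i j
    unfolding T'_def by (intro poly_fun_diff poly_fun_mult Suc.prems)
  moreover have "T' i j p = (if i = j then 1 else 0)" if "i < Suc D" "j < Suc D" for i j
    using that by (simp add: T'_def Suc.prems(2))
  ultimately obtain h where h: "poly_fun h" "h p = 1"
    "\<And>w x. (\<forall>i<Suc D. (\<Sum>j<Suc D. T' i j w * x j) = 0) \<Longrightarrow> h w * x 0 = 0"
    using Suc.IH[of T'] by blast
  have "h w * x 0 = 0" if rows: "\<forall>i<Suc (Suc D). (\<Sum>j<Suc (Suc D). T i j w * x j) = 0" for w x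
  proof (rule h(3), intro allI impI)
    fix i assume i: "i < Suc D"
    have r: "(\<Sum>j<Suc D. T l j w * x j) = - (T l ?e w * x ?e)" if "l < Suc (Suc D)" for l
      using rows[rule_format, OF that] unfolding sum.lessThan_Suc[of _ "Suc D"] by (rule eq_neg_iff_add_eq_0[THEN iffD2])
    have "(\<Sum>j<Suc D. T' i j w * x j) =
        T ?e ?e w * (\<Sum>j<Suc D. T i j w * x j) - T i ?e w * (\<Sum>j<Suc D. T ?e j w * x j)"
      by (simp only: T'_def left_diff_distrib sum_subtractf sum_distrib_left mult.assoc)
    also have "\<dots> = 0"
      unfolding r[OF less_SucI[OF i]] r[OF lessI] by (simp add: mult_ac)
    finally show "(\<Sum>j<Suc D. T' i j w * x j) = 0" .
  qed
  then show ?case using h(1,2) by blast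
qed

text \<open>If \<open>g\<close> vanishes on \<open>B\<close> and is \<open>1\<close> on the fibre over \<open>p\<close>, then multiplication by \<open>g\<close> modulo \<open>f\<close> has a
  matrix over the base which is the identity at \<open>p\<close> and annihilates \<open>(1, s, s\<^sup>2, \<dots>)\<close> at the points of \<open>B\<close>.\<close>
lemma line_proj_zariski_closed:
  fixes v :: "complex^'n::finite"
  assumes v: "v $ i0 = 1" and f: "poly_fun f" "line_poly v f D \<tau>" "\<tau> \<noteq> 0"
    and B: "algebraic_set B" "\<And>z. z \<in> B \<Longrightarrow> f z = 0"
    and p: "p $ i0 = 0" "p \<notin> line_proj v i0 ` B"
  shows "\<exists>h. poly_fun h \<and> h p \<noteq> 0 \<and> (\<forall>z\<in>B. h (line_proj v i0 z) = 0)"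
proof -
  obtain P where P: "\<And>w s. poly (P w) s = f (w + s *s v)"
     "\<And>l. poly_fun (\<lambda>w. coeff (P w) l)" "\<And>w. degree (P w) \<le> D" "\<And>w. coeff (P w) D = \<tau>"
    using f(2) unfolding line_poly_def by blast
  have P0: "P w \<noteq> 0" for w using P(4)[of w] f(3) by auto
  have degP: "degree (P w) = D" for w using P(3,4)[of w] f(3) by (metis le_antisym le_degree)
  have root: "poly (P (line_proj v i0 z)) (z $ i0) = 0" if "z \<in> B" for z
    using B(2)[OF that] by (simp add: P(1) line_proj_add)
  show ?thesis
  proof (cases D)
    case 0
    \<comment> \<open>For \<open>D = 0\<close> each \<open>P w\<close> is a nonzero constant, so
      \<open>f\<close> has no zeros.\<close>
    have "B = {}"
    proof (rule ccontr)
      assume "B \<noteq> {}"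
      then obtain z where z: "z \<in> B" by blast
      obtain c where c: "P (line_proj v i0 z) = [:c:]"
        using degP[of "line_proj v i0 z"] 0 by (metis degree_eq_zeroE)
      then show False using root[OF z] P0[of "line_proj v i0 z"] by auto
    qed
    then show ?thesis by (intro exI[of _ "\<lambda>_. 1"]) auto
  next
    case (Suc E)
    have disj: "p + s *s v \<notin> B" for s
      using p line_proj_on_line[OF v p(1), of s] by (metis image_eqI)
    obtain s0 where "f (p + s0 *s v) \<noteq> 0"
      using P0[of p] P(1)[of p] poly_all_0_iff_0[of "P p"] by auto
    note s0 = this
    obtain g where g: "poly_fun g" "\<And>z. z \<in> B \<Longrightarrow> g z = 0" "\<And>s. g (p + s *s v) = 1"
      using line_ideal_one[OF v p(1) B(1) f(1) B(2) s0 disj] by blast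
    obtain m where "line_poly v g m 0" using poly_fun_line_poly[OF g(1)] by blast
    then obtain G where G: "\<And>w s. poly (G w) s = g (w + s *s v)"
      "\<And>l. poly_fun (\<lambda>w. coeff (G w) l)" "\<And>w. degree (G w) \<le> m"
      unfolding line_poly_def by blast
    have Gp: "G p = 1"
      using G(1)[of p] g(3) by (simp add: poly_eq_poly_eq_iff[symmetric] fun_eq_iff)
    \<comment> \<open>Row \<open>i\<close> of the matrix: the remainder of
      \<open>s ^ i * G w\<close> modulo \<open>P w\<close>.\<close>
    have "\<exists>T. (\<forall>l. poly_fun (\<lambda>w. coeff (T w) l)) \<and> (\<forall>w l. l \<ge> D \<longrightarrow> coeff (T w) l = 0) \<and>
     (\<forall>w. P w dvd monom 1 i * G w - T w)" for i
    proof (rule poly_family_division[OF P(2-4) f(3), where m = "Suc (i + m)"])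
      show "poly_fun (\<lambda>w. coeff (monom 1 i * G w) l)" for l
        by (cases "l < i") (auto simp: coeff_monom_mult G(2))
      show "coeff (monom 1 i * G w) l = 0" if "Suc (i + m) \<le> l" for w l
        using that G(3)[of w] by (auto simp: coeff_monom_mult intro!: coeff_eq_0)
    qed
    then obtain T where T: "\<And>i l. poly_fun (\<lambda>w. coeff (T i w) l)"
      "\<And>i w l. l \<ge> D \<Longrightarrow> coeff (T i w) l = 0" "\<And>i w. P w dvd monom 1 i * G w - T i w"
      by metis
    \<comment> \<open>At \<open>p\<close> the multiplier is 1 and \<open>s ^ i\<close> has degree
      below \<open>D\<close>, so it is its own remainder.\<close>
    have Tp: "coeff (T i p) j = (if i = j then 1 else 0)" if "i < Suc E" for i j
    proof -
      have "degree (monom 1 i - T i p) < D"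
      proof (rule degree_lessI)
        show "\<forall>k\<ge>D. coeff (monom 1 i - T i p) k = 0" using T(2) that Suc by auto
      qed (use Suc in auto)
      moreover have "P p dvd monom 1 i - T i p" using T(3)[of p i] Gp by simp
      ultimately have "monom 1 i - T i p = 0" using degP[of p] by (metis dvd_imp_degree_le leD)
      then have "T i p = monom 1 i" by simp
      then show ?thesis by simp
    qed
    obtain h where h: "poly_fun h" "h p = 1"
      "\<And>w x. (\<forall>i<Suc E. (\<Sum>j<Suc E. coeff (T i w) j * x j) = 0) \<Longrightarrow> h w * x 0 = 0"
      using elimination[of "\<lambda>i j w. coeff (T i w) j" E p] T(1) Tp by blast
    have "h (line_proj v i0 z) = 0" if z: "z \<in> B" for z
    proof -
      define w where "w = line_proj v i0 z"
      define s where "s = z $ i0"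
      have "(\<Sum>j<Suc E. coeff (T i w) j * s ^ j) = 0" for i
      proof -
        have "poly (G w) s = 0" using g(2)[OF z] by (simp add: G(1) w_def s_def line_proj_add)
        moreover have "poly (P w) s = 0" using root[OF z] by (simp add: w_def s_def)
        ultimately have "poly (T i w) s = 0"
          using T(3)[of w i] by (auto simp: dvd_def) (metis eq_iff_diff_eq_0 mult_zero_left mult_zero_right poly_diff poly_mult)
        moreover have "poly (T i w) s = (\<Sum>j<Suc E. coeff (T i w) j * s ^ j)"
          unfolding poly_altdef using T(2)[of _ i w] Suc
          by (intro sum.mono_neutral_cong) (auto simp: coeff_eq_0 not_le not_less)
        ultimately show ?thesis by simp
      qed
      \<comment> \<open>The annihilated vector has entry \<open>s ^ 0 = 1\<close> at index 0, so
        \<open>h w = 0\<close>.\<close>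
      then show ?thesis using h(3)[of w "\<lambda>j. s ^ j"] by (simp add: w_def)
    qed
    then show ?thesis using h(1,2) by (intro exI[of _ h]) auto
  qed
qed

section \<open>Irreducible chains over coordinate subspaces\<close>

definition coord_subspace :: "'n set \<Rightarrow> (complex^'n::finite) set" where
  "coord_subspace J = {p. \<forall>i\<in>J. p $ i = 0}"

locale monic_projection =
  fixes v :: "complex^'n::finite" and i0 :: 'n and f :: "complex^'n \<Rightarrow> complex" and D :: nat and \<tau> :: complex
  assumes v: "v $ i0 = 1" and f: "poly_fun f" "line_poly v f D \<tau>" "\<tau> \<noteq> 0"
begin

lemma finite_fibre: "finite {s. f (p + s *s v) = 0}"
proof -
  obtain P where P: "\<And>w s. poly (P w) s = f (w + s *s v)" "\<And>w. coeff (P w) D = \<tau>"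
    using f(2) unfolding line_poly_def by blast
  have "P p \<noteq> 0" using P(2)[of p] f(3) by auto
  from poly_roots_finite[OF this] show ?thesis unfolding P(1) .
qed

text \<open>Fibres are finite, so a member of the chain with the smallest fibre over \<open>p\<close> has the same fibre as the
  intersection. This replaces Noetherianity in the application of Zorn's lemma.\<close>
lemma chain_Inter_covers:
  assumes c: "\<C> \<noteq> {}" "\<And>X Y. X \<in> \<C> \<Longrightarrow> Y \<in> \<C> \<Longrightarrow> X \<subseteq> Y \<or> Y \<subseteq> X"
    and sub: "\<And>X z. X \<in> \<C> \<Longrightarrow> z \<in> X \<Longrightarrow> f z = 0"
    and p: "p $ i0 = 0" "\<And>X. X \<in> \<C> \<Longrightarrow> p \<in> line_proj v i0 ` X"
  shows "p \<in> line_proj v i0 ` \<Inter>\<C>"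
proof -
  define F where "F = (\<lambda>X. {s. p + s *s v \<in> X})"
  have fin: "finite (F X)" if "X \<in> \<C>" for X
    by (rule finite_subset[OF _ finite_fibre[of p]]) (use sub that in \<open>auto simp: F_def\<close>)
  have ne: "F X \<noteq> {}" if X: "X \<in> \<C>" for X
  proof -
    obtain z where z: "z \<in> X" "p = line_proj v i0 z" using p(2)[OF X] by blast
    then have "z $ i0 \<in> F X" by (simp add: F_def line_proj_add)
    then show ?thesis by blast
  qed
  obtain X where X: "X \<in> \<C>" "\<And>Y. Y \<in> \<C> \<Longrightarrow> card (F X) \<le> card (F Y)"
    using c(1) ex_has_least_nat[of "\<lambda>X. X \<in> \<C>" _ "\<lambda>X. card (F X)"] by blast
  obtain s where s: "s \<in> F X" using ne[OF X(1)] by blast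
  have "s \<in> F Y" if Y: "Y \<in> \<C>" for Y
  proof (cases "X \<subseteq> Y")
    case True
    then show ?thesis using s by (auto simp: F_def)
  next
    case False
    then have "F Y \<subseteq> F X" using c(2)[OF X(1) Y] by (auto simp: F_def)
    then have "F Y = F X" using card_subset_eq[OF fin[OF X(1)]] X(2)[OF Y]
      by (meson card_mono fin X(1) le_antisym)
    then show ?thesis using s by simp
  qed
  then have "p + s *s v \<in> \<Inter>\<C>" by (auto simp: F_def)
  then show ?thesis using line_proj_on_line[OF v p(1), of s] by (metis image_eqI)
qed

text \<open>Zorn's lemma yields maximal elements, so it is applied to complements. Unions of chains
  become intersections, which are algebraic and still cover \<open>L\<close> because the fibres are
  finite.\<close>

lemma minimal_cover:
  assumes V: "algebraic_set V" "\<And>z. z \<in> V \<Longrightarrow> f z = 0"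
    and L: "\<And>p. p \<in> L \<Longrightarrow> p $ i0 = 0" "L \<subseteq> line_proj v i0 ` V"
  obtains X where "algebraic_set X" "X \<subseteq> V" "L \<subseteq> line_proj v i0 ` X"
    "\<And>Y. algebraic_set Y \<Longrightarrow> Y \<subseteq> X \<Longrightarrow> L \<subseteq> line_proj v i0 ` Y \<Longrightarrow> Y = X"
proof -
  define \<A> where "\<A> = uminus ` {X. algebraic_set X \<and> X \<subseteq> V \<and> L \<subseteq> line_proj v i0 ` X}"
  have mem: "U \<in> \<A> \<longleftrightarrow> algebraic_set (- U) \<and> - U \<subseteq> V \<and> L \<subseteq> line_proj v i0 ` (- U)" for U
    unfolding \<A>_def by (auto simp: image_iff)
  have "\<exists>M\<in>\<A>. \<forall>X\<in>\<A>. M \<subseteq> X \<longrightarrow> X = M"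
  proof (rule subset_Zorn_nonempty)
    show "\<A> \<noteq> {}" using V L(2) unfolding \<A>_def by blast
    fix \<U> assume U: "\<U> \<noteq> {}" "subset.chain \<A> \<U>"
    have sub: "\<And>U. U \<in> \<U> \<Longrightarrow> U \<in> \<A>" and cmp: "\<And>X Y. X \<in> \<U> \<Longrightarrow> Y \<in> \<U> \<Longrightarrow> X \<subseteq> Y \<or> Y \<subseteq> X"
      using U(2) unfolding subset_chain_def by blast+
    define \<C> where "\<C> = uminus ` \<U>"
    have eq: "- \<Union>\<U> = \<Inter>\<C>" unfolding \<C>_def by auto
    have C: "algebraic_set X" "X \<subseteq> V" "L \<subseteq> line_proj v i0 ` X" if "X \<in> \<C>" for X
      using that sub mem unfolding \<C>_def by auto
    have Cne: "\<C> \<noteq> {}" using U(1) unfolding \<C>_def by simp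
    have "algebraic_set (\<Inter>\<C>)" using C(1) by (rule algebraic_set_Inter)
    moreover have "\<Inter>\<C> \<subseteq> V" using Cne C(2) by blast
    moreover have "L \<subseteq> line_proj v i0 ` \<Inter>\<C>"
    proof
      fix p assume p: "p \<in> L"
      show "p \<in> line_proj v i0 ` \<Inter>\<C>"
      proof (rule chain_Inter_covers[OF Cne])
        show "X \<subseteq> Y \<or> Y \<subseteq> X" if "X \<in> \<C>" "Y \<in> \<C>" for X Y
          using that cmp unfolding \<C>_def by fastforce
        show "f z = 0" if "X \<in> \<C>" "z \<in> X" for X z using that C(2) V(2) by blast
        show "p $ i0 = 0" using L(1) p by blast
        show "p \<in> line_proj v i0 ` X" if "X \<in> \<C>" for X using C(3)[OF that] p by blast
      qed
    qed
    ultimately show "\<Union>\<U> \<in> \<A>" unfolding mem eq by blast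
  qed
  then obtain M where M: "M \<in> \<A>" "\<And>X. X \<in> \<A> \<Longrightarrow> M \<subseteq> X \<Longrightarrow> X = M" by blast
  show ?thesis
  proof (rule that[of "- M"])
    fix Y assume Y: "algebraic_set Y" "Y \<subseteq> - M" "L \<subseteq> line_proj v i0 ` Y"
    have "- Y \<in> \<A>" unfolding mem using Y M(1)[unfolded mem] by auto
    then have "- Y = M" using M(2)[of "- Y"] Y(2) by blast
    then show "Y = - M" by auto
  qed (use M(1)[unfolded mem] in auto)
qed

text \<open>If a minimal cover were a union of two proper algebraic subsets, each projection would
  miss a point of the coordinate subspace. Closedness gives polynomials that vanish on the two
  projections but not at these points; their product would vanish on the whole subspace, which is
  impossible as neither factor does.\<close>

lemma irreducible_cover:
  assumes V: "algebraic_set V" "\<And>z. z \<in> V \<Longrightarrow> f z = 0"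
    and J: "i0 \<in> J" "coord_subspace J \<subseteq> line_proj v i0 ` V"
  obtains X where "irreducible_alg X" "X \<subseteq> V" "line_proj v i0 ` X = coord_subspace J"
proof -
  let ?L = "coord_subspace J"
  let ?\<pi> = "line_proj v i0"
  have Li0: "p $ i0 = 0" if "p \<in> ?L" for p using that J(1) by (auto simp: coord_subspace_def)
  obtain X where X: "algebraic_set X" "X \<subseteq> V" "?L \<subseteq> ?\<pi> ` X"
    and min: "\<And>Y. algebraic_set Y \<Longrightarrow> Y \<subseteq> X \<Longrightarrow> ?L \<subseteq> ?\<pi> ` Y \<Longrightarrow> Y = X"
    using minimal_cover[OF V Li0 J(2)] by blast
  have Xf: "f z = 0" if "z \<in> X" for z using X(2) V(2) that by blast
  have alg\<pi>: "algebraic_set {z. ?\<pi> z \<in> ?L}"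
  proof -
    have "{z. ?\<pi> z \<in> ?L} = \<Inter>((\<lambda>i. {z. ?\<pi> z $ i = 0}) ` J)"
      by (auto simp: coord_subspace_def)
    then show ?thesis
      by (auto intro!: algebraic_set_Inter algebraic_set_zeros poly_fun_line_proj)
  qed
  \<comment> \<open>Cutting with the preimage of the subspace keeps the cover, so minimality makes
    the projection of \<open>X\<close> equal to the subspace.\<close>
  have "X \<inter> {z. ?\<pi> z \<in> ?L} = X"
    by (rule min) (use X alg\<pi> in \<open>auto intro: algebraic_set_inter\<close>)
  then have onto: "?\<pi> ` X = ?L" using X(3) by blast
  have "0 \<in> ?L" by (simp add: coord_subspace_def)
  then have "X \<noteq> {}" using X(3) by blast
  moreover have "X = A \<or> X = B" if AB: "algebraic_set A" "algebraic_set B" "X = A \<union> B" for A B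
  proof (rule ccontr)
    assume n: "\<not> (X = A \<or> X = B)"
    have sep: "\<exists>h p. poly_fun h \<and> p \<in> ?L \<and> h p \<noteq> 0 \<and> (\<forall>z\<in>Y. h (?\<pi> z) = 0)"
      if Y: "algebraic_set Y" "Y \<subseteq> X" "Y \<noteq> X" for Y
    proof -
      obtain p where p: "p \<in> ?L" "p \<notin> ?\<pi> ` Y" using min[OF Y(1,2)] Y(3) by blast
      have "\<And>z. z \<in> Y \<Longrightarrow> f z = 0" using Xf Y(2) by blast
      from line_proj_zariski_closed[OF v f Y(1) this Li0[OF p(1)] p(2)] p(1) show ?thesis by blast
    qed
    obtain h p where h: "poly_fun h" "p \<in> ?L" "h p \<noteq> 0" "\<And>z. z \<in> A \<Longrightarrow> h (?\<pi> z) = 0"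
      using sep[OF AB(1)] AB(3) n by blast
    obtain h' p' where h': "poly_fun h'" "p' \<in> ?L" "h' p' \<noteq> 0" "\<And>z. z \<in> B \<Longrightarrow> h' (?\<pi> z) = 0"
      using sep[OF AB(2)] AB(3) n by blast
    \<comment> \<open>The point found is on the line through \<open>p\<close> and \<open>p'\<close>,
      hence in the linear subspace.\<close>
    obtain s where s: "h (p + s *s (p' - p)) \<noteq> 0" "h' (p + s *s (p' - p)) \<noteq> 0"
      using poly_fun_mult_nonzero[OF h(1) h'(1) h(3) h'(3)] by blast
    have "p + s *s (p' - p) \<in> ?L" using h(2) h'(2) by (auto simp: coord_subspace_def)
    then obtain z where "z \<in> A \<union> B" "?\<pi> z = p + s *s (p' - p)" using onto AB(3) by (metis imageE)
    then show False using h(4) h'(4) s by (metis Un_iff)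
  qed
  ultimately have "irreducible_alg X" unfolding irreducible_alg_def using X(1) by blast
  then show ?thesis using that X(2) onto by blast
qed

text \<open>Induct on the number \<open>m\<close> of free coordinates. Take an irreducible cover
  \<open>X\<close>, set one more coordinate to zero and find the shorter chain inside
  \<open>X\<close>; the top inclusion is strict because the projections differ. There are
  \<open>m + 1\<close> members in all.\<close>

lemma irreducible_chain:
  assumes "card (UNIV - J) = m" "i0 \<in> J" "algebraic_set V" "\<And>z. z \<in> V \<Longrightarrow> f z = 0"
    "coord_subspace J \<subseteq> line_proj v i0 ` V"
  shows "\<exists>C. (\<forall>i\<le>m. irreducible_alg (C i) \<and> C i \<subseteq> V) \<and> (\<forall>i<m. C i \<subset> C (Suc i)) \<and>
     line_proj v i0 ` C m = coord_subspace J"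
  using assms
proof (induction m arbitrary: J V)
  case 0
  then obtain X where "irreducible_alg X" "X \<subseteq> V" "line_proj v i0 ` X = coord_subspace J"
    using irreducible_cover by blast
  then show ?case by (intro exI[of _ "\<lambda>_. X"]) auto
next
  case (Suc m)
  obtain X where X: "irreducible_alg X" "X \<subseteq> V" "line_proj v i0 ` X = coord_subspace J"
    using irreducible_cover[OF Suc.prems(3,4,2,5)] by blast
  have "UNIV - J \<noteq> {}" using Suc.prems(1) by (metis card.empty nat.distinct(1))
  then obtain j where j: "j \<notin> J" by blast
  have "card (UNIV - J - {j}) = m"
    using Suc.prems(1) j by (subst card_Diff_singleton) auto
  then have "card (UNIV - insert j J) = m"
    by (metis Diff_insert)
  moreover have "coord_subspace (insert j J) \<subseteq> line_proj v i0 ` X"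
    unfolding X(3) by (auto simp: coord_subspace_def)
  moreover have "algebraic_set X" using X(1) by (simp add: irreducible_alg_def)
  moreover have "\<And>z. z \<in> X \<Longrightarrow> f z = 0" using Suc.prems(4) X(2) by blast
  ultimately obtain C where C: "\<forall>i\<le>m. irreducible_alg (C i) \<and> C i \<subseteq> X" "\<forall>i<m. C i \<subset> C (Suc i)"
    "line_proj v i0 ` C m = coord_subspace (insert j J)"
    using Suc.IH[of "insert j J" X] Suc.prems(2) by blast
  define C' where "C' = C(Suc m := X)"
  have "axis j 1 \<in> coord_subspace J" "axis j 1 \<notin> coord_subspace (insert j J)"
    using j by (auto simp: coord_subspace_def axis_def)
  then have "C m \<noteq> X" using C(3) X(3) by auto
  then have "C m \<subset> X" using C(1) by auto
  then have "\<forall>i<Suc m. C' i \<subset> C' (Suc i)"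
    using C(2) unfolding C'_def by (auto simp: less_Suc_eq)
  moreover have "\<forall>i\<le>Suc m. irreducible_alg (C' i) \<and> C' i \<subseteq> V"
    using C(1) X(1,2) unfolding C'_def by (auto simp: le_Suc_eq)
  moreover have "line_proj v i0 ` C' (Suc m) = coord_subspace J" using X(3) by (simp add: C'_def)
  ultimately show ?case by blast
qed

end

section \<open>Lower bounds for the dimension\<close>

lemma alg_dim_ge:
  fixes V :: "(complex^'n::finite) set"
  assumes "\<forall>i\<le>n. irreducible_alg (C i) \<and> C i \<subseteq> V" "\<forall>i<n. C i \<subset> C (Suc i)"
  shows "n \<le> alg_dim V"
  unfolding alg_dim_def
proof (rule cSup_upper)
  show "bdd_above {n. \<exists>C :: nat \<Rightarrow> (complex ^ 'n) set.
      (\<forall>i\<le>n. irreducible_alg (C i) \<and> C i \<subseteq> V) \<and> (\<forall>i<n. C i \<subset> C (Suc i))}"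
  proof (rule bdd_aboveI[of _ "CARD('n)"])
    fix n assume "n \<in> {n. \<exists>C :: nat \<Rightarrow> (complex ^ 'n) set.
      (\<forall>i\<le>n. irreducible_alg (C i) \<and> C i \<subseteq> V) \<and> (\<forall>i<n. C i \<subset> C (Suc i))}"
    then show "n \<le> CARD('n)" using irreducible_chain_length[of n] by blast
  qed
qed (use assms in blast)

lemma alg_dim_ge_if_proj_onto:
  fixes V :: "(complex^'n::finite) set"
  assumes "v $ i0 = 1" "poly_fun f" "line_poly v f D \<tau>" "\<tau> \<noteq> 0"
    and "algebraic_set X" "X \<subseteq> V" "\<And>z. z \<in> X \<Longrightarrow> f z = 0"
    and "\<And>p. p $ i0 = 0 \<Longrightarrow> \<exists>s. p + s *s v \<in> X"
  shows "CARD('n) - 1 \<le> alg_dim V"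
proof -
  interpret monic_projection v i0 f D \<tau> using assms(1-4) by unfold_locales
  have "coord_subspace {i0} \<subseteq> line_proj v i0 ` X"
  proof
    fix p assume "p \<in> coord_subspace {i0}"
    then have p: "p $ i0 = 0" by (simp add: coord_subspace_def)
    then obtain s where "p + s *s v \<in> X" using assms(8) by blast
    then show "p \<in> line_proj v i0 ` X" using line_proj_on_line[OF assms(1) p, of s] by (metis image_eqI)
  qed
  moreover have "card (UNIV - {i0}) = CARD('n) - 1" by (simp add: card_Diff_singleton)
  ultimately obtain C where "\<forall>i\<le>CARD('n) - 1. irreducible_alg (C i) \<and> C i \<subseteq> X"
    "\<forall>i<CARD('n) - 1. C i \<subset> C (Suc i)"
    using irreducible_chain[of "{i0}" "CARD('n) - 1" X] assms(5,7) by blast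
  then show ?thesis using assms(6) by (intro alg_dim_ge[of _ C]) blast+
qed

text \<open>Rules out \<open>V = UNIV\<close>, on which no nonzero polynomial vanishes: a coordinate
  hyperplane already projects onto the base.\<close>

lemma alg_dim_UNIV_ge: "CARD('n) - 1 \<le> alg_dim (UNIV :: (complex^'n::finite) set)"
proof -
  fix i0 :: 'n
  show ?thesis
  proof (rule alg_dim_ge_if_proj_onto)
    show "line_poly (axis i0 1) (\<lambda>z. z $ i0) 1 (axis i0 1 $ i0)" by (rule line_poly_coord)
    show "algebraic_set {z. z $ i0 = 0}" by (rule algebraic_set_zeros) simp
    show "\<exists>s. p + s *s axis i0 1 \<in> {z. z $ i0 = 0}" if "p $ i0 = 0" for p :: "complex^'n"
      using that by (intro exI[of _ 0]) simp
  qed auto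
qed

section \<open>Growth of orbits\<close>

text \<open>Reconciles two ways of indexing: \<open>shift_map\<close> finds the position of an index
  by counting smaller ones, \<open>zc\<close> reads it off the sorted list.\<close>

lemma coord_list_nth_rank:
  assumes "i < CARD('n::{finite,linorder})"
  shows "card {j. j < (coord_list :: 'n list) ! i} = i"
proof -
  let ?xs = "coord_list :: 'n list"
  have len: "length ?xs = CARD('n)" and st: "sorted_wrt (<) ?xs" and set: "set ?xs = UNIV"
    by (auto simp: coord_list_def)
  have mono: "?xs ! a < ?xs ! b \<longleftrightarrow> a < b" if "a < CARD('n)" "b < CARD('n)" for a b
    using sorted_wrt_nth_less[OF st, of a b] sorted_wrt_nth_less[OF st, of b a] that len
    by (cases a b rule: linorder_cases) (auto dest: order.asym)
  have "{j. j < ?xs ! i} = (!) ?xs ` {..<i}"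
  proof (intro set_eqI iffI)
    fix j assume "j \<in> {j. j < ?xs ! i}"
    moreover obtain a where "a < CARD('n)" "j = ?xs ! a"
      using set len by (metis UNIV_I in_set_conv_nth)
    ultimately show "j \<in> (!) ?xs ` {..<i}" using mono assms by auto
  next
    fix j assume "j \<in> (!) ?xs ` {..<i}"
    then show "j \<in> {j. j < ?xs ! i}" using mono assms by auto
  qed
  moreover have "inj_on ((!) ?xs) {..<i}"
    using assms len by (intro inj_on_nth) (auto simp: coord_list_def)
  ultimately show ?thesis by (simp add: card_image)
qed

lemma coord_list_nth_surj: "\<exists>i<CARD('n). j = (coord_list :: 'n::{finite,linorder} list) ! i"
proof -
  have "j \<in> set (coord_list :: 'n list)" "length (coord_list :: 'n list) = CARD('n)"
    by (auto simp: coord_list_def)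
  then show ?thesis by (metis in_set_conv_nth)
qed

lemma zc_shift_map:
  fixes z :: "complex^'n::{finite,linorder}"
  shows "i + 1 < CARD('n) \<Longrightarrow> zc (shift_map \<delta> d z) i = zc z (i + 1)"
    and "i + 1 = CARD('n) \<Longrightarrow> zc (shift_map \<delta> d z) i = \<delta> * (zc z 1 ^ d - zc z 0)"
  by (subst zc_def[of "shift_map \<delta> d z"], simp add: shift_map_def Let_def coord_list_nth_rank)+

text \<open>Every coordinate is a later first coordinate, so the orbit is one scalar sequence and
  the map becomes a recurrence of order \<open>CARD('n)\<close>.\<close>

lemma zc_shift_map_iterate:
  fixes z :: "complex^'n::{finite,linorder}"
  assumes "i < CARD('n)"
  shows "zc ((shift_map \<delta> d ^^ n) z) i = zc ((shift_map \<delta> d ^^ (n + i)) z) 0"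
  using assms
proof (induction i arbitrary: n)
  case (Suc i)
  then have "zc ((shift_map \<delta> d ^^ n) z) (Suc i) = zc ((shift_map \<delta> d ^^ Suc n) z) i"
    by (simp add: zc_shift_map(1))
  also have "\<dots> = zc ((shift_map \<delta> d ^^ (Suc n + i)) z) 0" by (rule Suc.IH) (use Suc.prems in simp)
  finally show ?case by simp
qed simp

lemma shift_map_orbit_rec:
  fixes z :: "complex^'n::{finite,linorder}" and \<delta> :: complex and d :: nat
  defines "x \<equiv> \<lambda>m. zc ((shift_map \<delta> d ^^ m) z) 0"
  assumes "CARD('n) \<ge> 2"
  shows "x (n + CARD('n)) = \<delta> * (x (n + 1) ^ d - x n)"
proof -
  let ?k = "CARD('n)"
  have "x (Suc n + (?k - 1)) = zc ((shift_map \<delta> d ^^ Suc n) z) (?k - 1)"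
    unfolding x_def using assms(2) by (intro zc_shift_map_iterate[symmetric]) simp
  also have "\<dots> = \<delta> * (zc ((shift_map \<delta> d ^^ n) z) 1 ^ d - zc ((shift_map \<delta> d ^^ n) z) 0)"
    using assms by (simp add: zc_shift_map(2))
  also have "\<dots> = \<delta> * (x (n + 1) ^ d - x n)"
    unfolding x_def using assms zc_shift_map_iterate[where i = 1 and n = n and z = z and \<delta> = \<delta> and d = d] by simp
  finally show ?thesis using assms by simp
qed

lemma norm_le_card_mult:
  fixes y :: "complex^'n::finite"
  assumes "\<And>j. norm (y $ j) \<le> M"
  shows "norm y \<le> real CARD('n) * M"
proof -
  have "norm y \<le> (\<Sum>j\<in>UNIV. norm (y $ j))" unfolding norm_vec_def by (rule L2_set_le_sum) simp
  also have "\<dots> \<le> (\<Sum>j\<in>(UNIV::'n set). M)" by (rule sum_mono) (rule assms)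
  finally show ?thesis by simp
qed

text \<open>Division by \<open>d ^ n\<close> turns the errors into increments of size at most
  \<open>a / 2 ^ (n + 1)\<close>. They sum to at most \<open>a\<close>, which gives convergence and
  limits the loss from \<open>L 0\<close>.\<close>

lemma perturbed_geometric_growth_limit:
  fixes L :: "nat \<Rightarrow> real" and d :: nat
  assumes d: "d \<ge> 2" and L: "\<And>n. \<bar>L (Suc n) - real d * L n\<bar> \<le> a"
  shows "\<exists>l. (\<lambda>n. L n / real d ^ n) \<longlonglongrightarrow> l \<and> L 0 - a \<le> l"
proof -
  define u where "u = (\<lambda>n. L n / real d ^ n)"
  have a0: "a \<ge> 0" using L[of 0] by linarith
  have du: "\<bar>u (Suc n) - u n\<bar> \<le> a * (1/2) ^ Suc n" for n
  proof -
    have "u (Suc n) - u n = (L (Suc n) - real d * L n) / real d ^ Suc n"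
      using d by (simp add: u_def field_simps)
    then have "\<bar>u (Suc n) - u n\<bar> = \<bar>L (Suc n) - real d * L n\<bar> / real d ^ Suc n"
      using d by (simp add: abs_divide)
    also have "\<dots> \<le> a / 2 ^ Suc n"
      using L[of n] a0 d by (intro frac_le power_mono) auto
    finally show ?thesis by (simp add: power_divide)
  qed
  have "summable (\<lambda>n. u (Suc n) - u n)"
  proof (rule summable_comparison_test')
    show "summable (\<lambda>n. a * (1/2 :: real) ^ Suc n)"
      by (intro summable_mult summable_Suc_iff[THEN iffD2] summable_geometric) simp
    show "norm (u (Suc n) - u n) \<le> a * (1/2) ^ Suc n" for n using du[of n] by simp
  qed
  from summable_LIMSEQ[OF this] have "convergent (\<lambda>n. u n - u 0)"
    unfolding sum_lessThan_telescope convergent_def by blast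
  then have "convergent u" by (simp add: convergent_diff_const_right_iff)
  then obtain l where l: "u \<longlonglongrightarrow> l" unfolding convergent_def by blast
  \<comment> \<open>The exact partial sum of the error bounds is kept, since the final bound alone
    is not inductive.\<close>
  have "u n \<ge> u 0 - a * (1 - (1/2) ^ n)" for n
  proof (induction n)
    case (Suc n)
    define t where "t = a * (1/2) ^ n"
    have "u 0 - a + t \<le> u n" using Suc by (simp add: t_def right_diff_distrib)
    moreover have "\<bar>u (Suc n) - u n\<bar> \<le> t / 2" using du[of n] by (simp add: t_def)
    ultimately have "u 0 - a + t / 2 \<le> u (Suc n)" by linarith
    then show ?case by (simp add: t_def right_diff_distrib)
  qed simp
  moreover have "u 0 - a * (1 - (1/2) ^ n) \<ge> L 0 - a" for n
    using a0 by (simp add: u_def algebra_simps)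
  ultimately have "\<forall>n. L 0 - a \<le> u n" by (meson order_trans)
  then have "L 0 - a \<le> l" by (intro LIMSEQ_le_const[OF l]) auto
  then show ?thesis using l unfolding u_def by blast
qed

lemma ln_growth_bound:
  fixes M M' e :: real
  assumes "e > 0" "M > 0" "e / 2 * M ^ d \<le> M'" "M' \<le> 2 * e * M ^ d"
  shows "\<bar>ln M' - real d * ln M\<bar> \<le> \<bar>ln (e / 2)\<bar> + \<bar>ln (2 * e)\<bar>"
proof -
  have pos: "e / 2 * M ^ d > 0" using assms by simp
  then have "M' > 0" using assms by linarith
  have le: "ln (e / 2 * M ^ d) \<le> ln M'" "ln M' \<le> ln (2 * e * M ^ d)"
    using assms pos \<open>M' > 0\<close> by (auto intro: ln_mono simp: ln_le_cancel_iff)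
  have "ln (b * M ^ d) = ln b + real d * ln M" if "b > 0" for b
    using that assms(2) by (simp add: ln_mult ln_realpow)
  from this[of "e / 2"] this[of "2 * e"]
  have "ln (e / 2 * M ^ d) = ln (e / 2) + real d * ln M"
    "ln (2 * e * M ^ d) = ln (2 * e) + real d * ln M" using assms(1) by simp_all
  with le show ?thesis by linarith
qed

text \<open>Split the scalar orbit into blocks of length \<open>K\<close>. If the block maximum
  \<open>M n\<close> is large and dominates the preceding value, the power term governs the
  recurrence, so \<open>M (Suc n)\<close> is comparable to \<open>M n ^ d\<close>. The logarithms
  then converge after rescaling; this also identifies the value of \<open>lim\<close>, which says
  nothing without convergence.\<close>

lemma green_plus_ge:
  fixes \<delta> :: complex and c :: real
  assumes k: "CARD('n::{finite,linorder}) \<ge> 2" and \<delta>: "\<delta> \<noteq> 0" and d: "d \<ge> 2"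
  shows "\<exists>R>0. \<forall>z::(complex, 'n) vec. \<forall>i. 1 \<le> i \<longrightarrow> i < CARD('n) \<longrightarrow> R \<le> norm (zc z i) \<longrightarrow>
     norm (zc z 0) \<le> norm (zc z i) \<longrightarrow> c \<le> green_plus \<delta> d z"
proof -
  define k where "k = CARD('n)"
  define K where "K = k - 1"
  have kK: "k = Suc K" and K: "K \<ge> 1" using k by (auto simp: K_def k_def)
  define e where "e = norm \<delta>"
  have e: "e > 0" using \<delta> by (simp add: e_def)
  define a where "a = \<bar>ln (e / 2)\<bar> + \<bar>ln (2 * e)\<bar>"
  \<comment> \<open>The entry 2 gives \<open>M n \<le> M n ^ d / 2\<close>, the entry
    \<open>2 / e\<close> makes \<open>M\<close> nondecreasing, and \<open>exp (c + a)\<close> starts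
    \<open>ln M\<close> at \<open>c + a\<close> or more.\<close>
  define R where "R = max 2 (max (2 / e) (exp (c + a)))"
  have R: "R \<ge> 2" "R \<ge> 2 / e" "R \<ge> exp (c + a)" by (auto simp: R_def)
  have "c \<le> green_plus \<delta> d z" if i: "1 \<le> i" "i < CARD('n)" "R \<le> norm (zc z i)" "norm (zc z 0) \<le> norm (zc z i)"
    for z :: "(complex, 'n) vec" and i
  proof -
    define x where "x = (\<lambda>m. zc ((shift_map \<delta> d ^^ m) z) 0)"
    have rec: "x (n + k) = \<delta> * (x (n + 1) ^ d - x n)" for n
      unfolding x_def k_def by (rule shift_map_orbit_rec[OF k])
    \<comment> \<open>The block leaves out the index \<open>K * n\<close>, the last one of the block
      before; for \<open>n = 0\<close> it belongs to the first coordinate of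
      \<open>z\<close>.\<close>
    define M where "M = (\<lambda>n. Max ((\<lambda>j. norm (x (K * n + j))) ` {1..K}))"
    have Mge: "norm (x (K * n + j)) \<le> M n" if "1 \<le> j" "j \<le> K" for n j
      unfolding M_def using that by (intro Max_ge) auto
    have Mex: "\<exists>j\<in>{1..K}. M n = norm (x (K * n + j))" for n
    proof -
      have "M n \<in> (\<lambda>j. norm (x (K * n + j))) ` {1..K}" unfolding M_def using K by (intro Max_in) auto
      then show ?thesis by blast
    qed
    have step: "e / 2 * M n ^ d \<le> M (Suc n) \<and> M (Suc n) \<le> 2 * e * M n ^ d \<and> M n \<le> M (Suc n)"
      if h: "R \<le> M n" "norm (x (K * n)) \<le> M n" for n
    proof -
      have M2: "M n \<ge> 2" using h R by linarith
      have Md: "M n * M n \<le> M n ^ d"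
        using power_increasing[OF d, of "M n"] M2 by (simp add: power2_eq_square)
      have "2 * M n \<le> M n * M n" using M2 by (intro mult_right_mono) auto
      then have Md2: "2 * M n \<le> M n ^ d" using Md by linarith
      have old: "norm (x (K * n + j)) \<le> M n" if "j \<le> K" for j
        using Mge[of j n] h(2) that by (cases j) auto
      \<comment> \<open>As \<open>k = Suc K\<close>, a value in the next block comes from the same
        position in this block and its predecessor.\<close>
      have new: "x (K * Suc n + Suc j) = \<delta> * (x (K * n + Suc j) ^ d - x (K * n + j))" for j
        using rec[of "K * n + j"] by (simp add: kK algebra_simps)
      have upper: "norm (x (K * Suc n + Suc j)) \<le> 2 * e * M n ^ d" if "Suc j \<le> K" for j
      proof -
        have "norm (x (K * n + Suc j) ^ d - x (K * n + j)) \<le> norm (x (K * n + Suc j)) ^ d + norm (x (K * n + j))"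
          by (metis norm_power norm_triangle_ineq4)
        also have "\<dots> \<le> M n ^ d + M n"
          using old[of j] old[of "Suc j"] that by (intro add_mono power_mono) auto
        also have "\<dots> \<le> 2 * M n ^ d" using Md2 M2 by linarith
        finally show ?thesis using e unfolding new norm_mult e_def by simp
      qed
      obtain j where j: "j \<in> {1..K}" "M (Suc n) = norm (x (K * Suc n + j))" using Mex by blast
      then have up: "M (Suc n) \<le> 2 * e * M n ^ d" using upper[of "j - 1"] by simp
      \<comment> \<open>The position where the maximum is attained gives the lower bound at the same
        position of the next block.\<close>
      obtain l where l: "l \<in> {1..K}" "M n = norm (x (K * n + l))" using Mex by blast
      define l' where "l' = l - 1"
      have l': "l = Suc l'" using l(1) by (simp add: l'_def)
      have "M n ^ d / 2 \<le> M n ^ d - M n" using Md2 by linarith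
      also have "\<dots> \<le> norm (x (K * n + Suc l') ^ d) - norm (x (K * n + l'))"
        using old[of l'] l unfolding l' by (simp add: norm_power)
      also have "\<dots> \<le> norm (x (K * n + Suc l') ^ d - x (K * n + l'))" by (rule norm_triangle_ineq2)
      finally have "e * (M n ^ d / 2) \<le> norm (x (K * Suc n + Suc l'))"
        using e unfolding new norm_mult e_def by simp
      also have "\<dots> \<le> M (Suc n)" using Mge[of "Suc l'" "Suc n"] l unfolding l' by simp
      finally have low: "e / 2 * M n ^ d \<le> M (Suc n)" by simp
      have "2 / e \<le> M n" using R h by linarith
      then have "1 \<le> e / 2 * M n" using e by (simp add: field_simps)
      then have "1 * M n \<le> e / 2 * M n * M n" using M2 by (intro mult_right_mono) auto
      also have "\<dots> \<le> e / 2 * M n ^ d" using Md e by (simp add: mult.assoc)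
      finally show ?thesis using low up by simp
    qed
    have inv: "R \<le> M n \<and> norm (x (K * n)) \<le> M n" for n
    proof (induction n)
      case 0
      have "norm (zc z i) = norm (x (K * 0 + i))"
        unfolding x_def using zc_shift_map_iterate[where i = i and n = 0 and z = z and \<delta> = \<delta> and d = d] i by simp
      also have "\<dots> \<le> M 0" using i kK unfolding k_def by (intro Mge) auto
      finally show ?case using i by (simp add: x_def)
    next
      case (Suc n)
      \<comment> \<open>This index is the last of block \<open>n\<close>, so growth of
        \<open>M\<close> preserves the invariant.\<close>
      have "norm (x (K * Suc n)) \<le> M n" using Mge[of K n] K by (simp add: algebra_simps)
      then show ?case using step[of n] Suc by linarith
    qed
    have Mpos: "M n \<ge> 2" for n using inv[of n] R by linarith
    define y where "y = (\<lambda>n. (shift_map \<delta> d ^^ (K * n)) z)"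
    have ycomp: "y n $ (coord_list ! j) = x (K * n + j)" if "j < k" for j n
      using zc_shift_map_iterate[where i = j and n = "K * n" and z = z and \<delta> = \<delta> and d = d] that unfolding y_def x_def k_def zc_def by simp
    have ylow: "M n \<le> norm (y n)" for n
    proof -
      obtain j where "j \<in> {1..K}" "M n = norm (x (K * n + j))" using Mex by blast
      then have "M n = norm (y n $ (coord_list ! j))" using ycomp[of j n] kK by simp
      then show ?thesis by (simp add: Finite_Cartesian_Product.norm_nth_le)
    qed
    have yup: "norm (y n) \<le> real k * M n" for n
      unfolding k_def
    proof (rule norm_le_card_mult)
      fix j :: 'n
      obtain l where l: "l < k" "j = coord_list ! l" using coord_list_nth_surj[of j] unfolding k_def by blast
      show "norm (y n $ j) \<le> M n"
        unfolding l(2) ycomp[OF l(1)] using Mge[of l n] inv[of n] l(1) kK by (cases l) auto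
    qed
    define L where "L = (\<lambda>n. ln (M n))"
    have "\<bar>L (Suc n) - real d * L n\<bar> \<le> a" for n
      unfolding L_def a_def using step[of n] inv[of n] Mpos[of n] by (intro ln_growth_bound e) auto
    from perturbed_geometric_growth_limit[of d L a, OF d this]
    obtain l where l: "(\<lambda>n. L n / real d ^ n) \<longlonglongrightarrow> l" "L 0 - a \<le> l" by blast
    have "c + a \<le> L 0"
      unfolding L_def using inv[of 0] R(3) Mpos[of 0] by (subst ln_ge_iff) auto
    then have "c \<le> l" using l(2) by linarith
    have k1: "real k \<ge> 1" using kK by simp
    have lp: "logplus (norm (y n)) = ln (norm (y n))" for n
      using ylow[of n] Mpos[of n] by (simp add: logplus_def)
    have lo: "L n \<le> ln (norm (y n))" for n
      unfolding L_def using ylow[of n] Mpos[of n] by (subst ln_le_cancel_iff) auto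
    have hi: "ln (norm (y n)) \<le> L n + ln (real k)" for n
    proof -
      have "ln (norm (y n)) \<le> ln (real k * M n)"
        using yup[of n] ylow[of n] Mpos[of n] k1 by (subst ln_le_cancel_iff) auto
      then show ?thesis unfolding L_def using Mpos[of n] k1 by (simp add: ln_mult)
    qed
    \<comment> \<open>Comparing the norm with the block maximum costs a factor \<open>k\<close>,
      which disappears after division of the logarithm by \<open>d ^ n\<close>.\<close>
    have "(\<lambda>n. ln (real k) / real d ^ n) \<longlonglongrightarrow> 0"
      using d by (intro LIMSEQ_divide_realpow_zero) auto
    from tendsto_add[OF l(1) this] have l2: "(\<lambda>n. L n / real d ^ n + ln (real k) / real d ^ n) \<longlonglongrightarrow> l" by simp
    have "(\<lambda>n. logplus (norm (y n)) / real d ^ n) \<longlonglongrightarrow> l"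
    proof (rule tendsto_sandwich[OF _ _ l(1) l2])
      show "\<forall>\<^sub>F n in sequentially. L n / real d ^ n \<le> logplus (norm (y n)) / real d ^ n"
        unfolding lp using lo by (intro always_eventually allI divide_right_mono) auto
      show "\<forall>\<^sub>F n in sequentially. logplus (norm (y n)) / real d ^ n \<le> L n / real d ^ n + ln (real k) / real d ^ n"
        unfolding lp add_divide_distrib[symmetric] using hi by (intro always_eventually allI divide_right_mono) auto
    qed
    then have "green_plus \<delta> d z = l"
      unfolding green_plus_def y_def K_def k_def by (rule limI)
    then show ?thesis using \<open>c \<le> l\<close> by simp
  qed
  moreover have "R > 0" using R by linarith
  ultimately show ?thesis by blast
qed

section \<open>Moving the variety\<close>

lemma algebraic_set_closed:
  assumes "algebraic_set (V :: (complex^'n::finite) set)"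
  shows "closed V"
proof -
  obtain P where P: "\<forall>f\<in>P. poly_fun f" "V = {z. \<forall>f\<in>P. f z = 0}"
    using assms unfolding algebraic_set_def by blast
  have "V = (\<Inter>f\<in>P. {z. f z = 0})" unfolding P(2) by auto
  moreover have "closed {z. f z = 0}" if "f \<in> P" for f
    using poly_fun_continuous P(1) that
    by (intro closed_Collect_eq continuous_on_const) auto
  ultimately show ?thesis by auto
qed

text \<open>The linear bound makes the projection proper on \<open>V\<close>: the part of
  \<open>V\<close> over the closed unit ball about \<open>p\<close> is compact, so the distance to
  \<open>p\<close> has a minimum there if that part is nonempty, positive because the fibre over
  \<open>p\<close> avoids \<open>V\<close>. Elsewhere the distance exceeds 1.\<close>

lemma line_proj_dist_pos:
  fixes V :: "(complex^'n::finite) set"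
  assumes V: "closed V" and K: "\<And>z. z \<in> V \<Longrightarrow> norm (z $ i0) \<le> K * (1 + norm (line_proj v i0 z))"
    and "K > 0" and p: "\<And>s. p + s *s v \<notin> V"
  obtains \<epsilon> where "\<epsilon> > 0" "\<And>z. z \<in> V \<Longrightarrow> \<epsilon> \<le> norm (line_proj v i0 z - p)"
proof -
  have cont: "continuous_on A (\<lambda>z. norm (line_proj v i0 z - p))" for A
    unfolding line_proj_def vector_scalar_mult_def by (intro continuous_intros)
  define S where "S = V \<inter> {z. norm (line_proj v i0 z - p) \<le> 1}"
  have "closed S" unfolding S_def
    by (intro closed_Int V closed_Collect_le cont continuous_on_const)
  moreover have "bounded S"
  proof -
    define W where "W = 1 + norm p"
    have "norm z \<le> W + K * (1 + W) * norm v" if "z \<in> S" for z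
    proof -
      have z: "z \<in> V" "norm (line_proj v i0 z - p) \<le> 1" using that by (auto simp: S_def)
      have w: "norm (line_proj v i0 z) \<le> W"
        using z(2) norm_triangle_sub[of "line_proj v i0 z" p] unfolding W_def by linarith
      then have "K * (1 + norm (line_proj v i0 z)) \<le> K * (1 + W)"
        using \<open>K > 0\<close> by (intro mult_left_mono) auto
      then have "norm (z $ i0) \<le> K * (1 + W)" using K[OF z(1)] by linarith
      then have "norm ((z $ i0) *s v) \<le> K * (1 + W) * norm v"
        unfolding norm_vector_scalar_mult by (intro mult_right_mono) auto
      then show ?thesis
        using w norm_triangle_ineq[of "line_proj v i0 z" "(z $ i0) *s v"] unfolding line_proj_add by linarith
    qed
    then show ?thesis by (auto simp: bounded_iff)
  qed
  ultimately have "compact S" by (simp add: compact_eq_bounded_closed)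
  have pos: "norm (line_proj v i0 z - p) > 0" if "z \<in> V" for z
  proof -
    have "line_proj v i0 z \<noteq> p" using p[of "z $ i0"] that line_proj_add[of v i0 z] by metis
    then show ?thesis by simp
  qed
  show ?thesis
  proof (cases "S = {}")
    case True
    then have "1 \<le> norm (line_proj v i0 z - p)" if "z \<in> V" for z
      using that by (auto simp: S_def not_le)
    then show ?thesis using that[of 1] by simp
  next
    case False
    from continuous_attains_inf[OF \<open>compact S\<close> False cont]
    obtain z0 where z0: "z0 \<in> S" "\<And>z. z \<in> S \<Longrightarrow> norm (line_proj v i0 z0 - p) \<le> norm (line_proj v i0 z - p)"
      by blast
    show ?thesis
    proof (rule that[of "norm (line_proj v i0 z0 - p)"])
      show "0 < norm (line_proj v i0 z0 - p)" using pos z0(1) by (simp add: S_def)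
      show "norm (line_proj v i0 z0 - p) \<le> norm (line_proj v i0 z - p)" if "z \<in> V" for z
        using z0 that by (cases "z \<in> S") (auto simp: S_def)
    qed
  qed
qed

section \<open>Affine automorphisms and the final estimate\<close>

text \<open>A complex linear map in finite dimension is real linear, hence bounded, and is the
  derivative of its translates.\<close>

lemma holomorphic_map_affine:
  fixes A :: "complex^'n::finite \<Rightarrow> complex^'n"
  assumes "\<And>x y. A (x + y) = A x + A y" "\<And>c x. A (c *s x) = c *s A x"
  shows "holomorphic_map (\<lambda>z. A z + b)"
proof -
  have "r *\<^sub>R x = of_real r *s x" for r and x :: "complex^'n"
    by (simp add: vec_eq_iff scaleR_conv_of_real[where 'a = complex])
  then have "A (r *\<^sub>R x) = r *\<^sub>R A x" for r x
    using assms(2) by metis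
  then have "linear A" using assms(1) by (intro linearI) auto
  then have "bounded_linear A" by (simp add: linear_conv_bounded_linear)
  then have "((\<lambda>z. A z + b) has_derivative A) (at z)" for z
    by (auto intro!: derivative_eq_intros bounded_linear_imp_has_derivative)
  then show ?thesis unfolding holomorphic_map_def using assms(2) by blast
qed

text \<open>Base part and fibre coordinate determine \<open>z\<close>, so the inverse can be written
  down: shrink the base part, put the fibre back along \<open>v\<close> and translate by
  \<open>p\<close>.\<close>

lemma automorphism_rescale:
  fixes v p :: "complex^'n::finite"
  assumes v: "v $ i0 = 1" and p: "p $ i0 = 0" and l: "\<mu> \<noteq> 0"
  shows "automorphism (\<lambda>z. \<mu> *s (line_proj v i0 z - p) + (z $ i0) *s axis i0 1)"
proof -
  let ?F = "\<lambda>z. \<mu> *s (line_proj v i0 z - p) + (z $ i0) *s axis i0 1"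
  let ?A = "\<lambda>z. \<mu> *s line_proj v i0 z + (z $ i0) *s axis i0 1"
  let ?B = "\<lambda>y. (1 / \<mu>) *s line_proj (axis i0 1) i0 y + (y $ i0) *s v"
  let ?G = "\<lambda>y. ?B y + p"
  have GF: "?G (?F z) = z" for z
    using v p l by (auto simp: vec_eq_iff line_proj_def axis_def field_simps)
  have FG: "?F (?G y) = y" for y
    using v p l by (auto simp: vec_eq_iff line_proj_def axis_def field_simps)
  have "bij ?F" by (rule o_bij[of ?G]) (use GF FG in \<open>auto simp: fun_eq_iff\<close>)
  moreover have "inv ?F = ?G" by (rule inv_equality) (rule GF, rule FG)
  moreover have "holomorphic_map (\<lambda>z. ?A z + - (\<mu> *s p))"
    by (rule holomorphic_map_affine) (auto simp: vec_eq_iff line_proj_def algebra_simps)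
  moreover have "(\<lambda>z. ?A z + - (\<mu> *s p)) = ?F" by (auto simp: fun_eq_iff vec_eq_iff algebra_simps)
  moreover have "holomorphic_map ?G"
    by (rule holomorphic_map_affine) (auto simp: vec_eq_iff line_proj_def algebra_simps)
  ultimately show ?thesis unfolding automorphism_def by simp
qed

text \<open>The dimension excludes \<open>V = UNIV\<close>, so some nonzero polynomial vanishes on
  \<open>V\<close> and provides the direction. If \<open>V\<close> met every fibre, its dimension
  would be at least \<open>CARD('n) - 1\<close>.\<close>

lemma low_dimension_avoids_line:
  fixes V :: "(complex^'n::finite) set"
  assumes "algebraic_set V" "alg_dim V < CARD('n) - 1"
  obtains v p K where "v $ i0 = 1" "p $ i0 = 0" "K > 0" "\<And>s. p + s *s v \<notin> V"
    "\<And>z. z \<in> V \<Longrightarrow> norm (z $ i0) \<le> K * (1 + norm (line_proj v i0 z))"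
proof -
  have "V \<noteq> UNIV" using alg_dim_UNIV_ge[where 'n = 'n] assms(2) by auto
  then obtain z0 where "z0 \<notin> V" by blast
  from algebraic_set_separate[OF assms(1) this]
  obtain f where f: "poly_fun f" "\<And>x. x \<in> V \<Longrightarrow> f x = 0" "f z0 \<noteq> 0" by blast
  obtain v D \<tau> K where v: "v $ i0 = 1" "\<tau> \<noteq> 0" "line_poly v f D \<tau>" "K > 0"
    and K: "\<And>z. f z = 0 \<Longrightarrow> norm (z $ i0) \<le> K * (1 + norm (z - (z $ i0) *s v))"
    using noncharacteristic_direction[OF f(1,3), of i0] by metis
  have "\<exists>p. p $ i0 = 0 \<and> (\<forall>s. p + s *s v \<notin> V)"
  proof (rule ccontr)
    assume "\<not> ?thesis"
    then have "\<And>p. p $ i0 = 0 \<Longrightarrow> \<exists>s. p + s *s v \<in> V" by blast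
    from alg_dim_ge_if_proj_onto[OF v(1) f(1) v(3,2) assms(1) order_refl f(2) this]
    show False using assms(2) by simp
  qed
  then obtain p where "p $ i0 = 0" "\<And>s. p + s *s v \<notin> V" by blast
  then show ?thesis using that[OF v(1) _ v(4)] K f(2) unfolding line_proj_def by blast
qed

theorem theorem4p4:
  fixes \<delta> :: complex and d :: nat and c :: real
    and V :: "(complex ^ 'n::{finite,linorder}) set"
  assumes "CARD('n) \<ge> 3"
    and "\<delta> \<noteq> 0"
    and "d \<ge> 2"
    and "c > 0"
    and "algebraic_set V"
    and "alg_dim V = CARD('n) - 2"
  shows "\<exists>\<Phi>. automorphism \<Phi> \<and> {z. green_plus \<delta> d z < c} \<inter> \<Phi> ` V = {}"
proof -
  \<comment> \<open>The fibre coordinate becomes the first coordinate, which has to be dominated but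
    not large.\<close>
  define i0 where "i0 = (coord_list :: 'n list) ! 0"
  let ?k = "real CARD('n)"
  have "CARD('n) \<ge> 2" using assms(1) by simp
  from green_plus_ge[OF this assms(2,3), of c] obtain R where "R > 0" and
    R: "\<And>(z::(complex, 'n) vec) i. 1 \<le> i \<Longrightarrow> i < CARD('n) \<Longrightarrow> R \<le> norm (zc z i) \<Longrightarrow>
     norm (zc z 0) \<le> norm (zc z i) \<Longrightarrow> c \<le> green_plus \<delta> d z"
    by blast
  have "alg_dim V < CARD('n) - 1" using assms(1,6) by simp
  then obtain v p K where v: "v $ i0 = 1" and p: "p $ i0 = 0" "\<And>s. p + s *s v \<notin> V" and "K > 0"
    and K: "\<And>z. z \<in> V \<Longrightarrow> norm (z $ i0) \<le> K * (1 + norm (line_proj v i0 z))"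
    using low_dimension_avoids_line[OF assms(5), of i0] by metis
  obtain \<epsilon> where "\<epsilon> > 0" and \<epsilon>: "\<And>z. z \<in> V \<Longrightarrow> \<epsilon> \<le> norm (line_proj v i0 z - p)"
    using line_proj_dist_pos[OF algebraic_set_closed[OF assms(5)] K \<open>K > 0\<close> p(2)] by metis
  \<comment> \<open>\<open>Q\<close> bounds the fibre coordinate by \<open>Q * norm u\<close>, using
    \<open>norm u \<ge> \<epsilon>\<close> to absorb the constants. In \<open>\<mu>\<close>, the
    summand \<open>R / \<epsilon>\<close> gives modulus at least \<open>R\<close>, \<open>Q\<close>
    gives domination, and the factor \<open>?k\<close> pays for passing from \<open>norm u\<close>
    to its largest coordinate.\<close>
  define Q where "Q = K * ((1 + norm p) / \<epsilon> + 1)"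
  define \<mu> where "\<mu> = ?k * (R / \<epsilon> + Q)"
  have Q: "Q > 0" using \<open>K > 0\<close> \<open>\<epsilon> > 0\<close> by (simp add: Q_def add_nonneg_pos)
  have "\<mu> > 0" using \<open>R > 0\<close> \<open>\<epsilon> > 0\<close> Q by (simp add: \<mu>_def add_pos_pos)
  define \<Phi> where "\<Phi> = (\<lambda>z. of_real \<mu> *s (line_proj v i0 z - p) + (z $ i0) *s axis i0 1)"
  have "automorphism \<Phi>" unfolding \<Phi>_def
    by (rule automorphism_rescale[OF v p(1)]) (use \<open>\<mu> > 0\<close> in simp)
  moreover have "c \<le> green_plus \<delta> d (\<Phi> z)" if z: "z \<in> V" for z
  proof -
    define u where "u = line_proj v i0 z - p"
    have \<Phi>z: "\<Phi> z = of_real \<mu> *s u + (z $ i0) *s axis i0 1" by (simp only: \<Phi>_def u_def)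
    have u0: "u $ i0 = 0" using v p by (simp add: u_def line_proj_def)
    have u\<epsilon>: "\<epsilon> \<le> norm u" using \<epsilon>[OF z] by (simp add: u_def)
    define m where "m = Max (range (\<lambda>j. norm (u $ j)))"
    have "m \<in> range (\<lambda>j. norm (u $ j))" unfolding m_def by (intro Max_in) auto
    \<comment> \<open>A coordinate of largest modulus; it is not the first, where \<open>u\<close>
      vanishes.\<close>
    then obtain j where j: "m = norm (u $ j)" by blast
    have "norm (u $ l) \<le> m" for l unfolding m_def by (intro Max_ge) auto
    then have um: "norm u \<le> ?k * m" by (rule norm_le_card_mult)
    have "m > 0"
    proof (rule ccontr)
      assume "\<not> m > 0"
      then have "?k * m \<le> 0" by (simp add: mult_nonneg_nonpos)
      then show False using um u\<epsilon> \<open>\<epsilon> > 0\<close> by linarith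
    qed
    then have "j \<noteq> i0" using j u0 by auto
    obtain i where i: "i < CARD('n)" "j = coord_list ! i" using coord_list_nth_surj[of j] by blast
    have "1 \<le> i" using \<open>j \<noteq> i0\<close> i(2) unfolding i0_def by (cases i) auto
    have \<Phi>j: "norm (zc (\<Phi> z) i) = \<mu> * m"
      using \<open>j \<noteq> i0\<close> \<open>\<mu> > 0\<close> j
      by (simp add: zc_def i(2)[symmetric] \<Phi>z axis_def norm_mult)
    have \<Phi>0: "norm (zc (\<Phi> z) 0) = norm (z $ i0)"
      using u0 by (simp add: zc_def i0_def[symmetric] \<Phi>z)
    have lm: "\<mu> * m = (R / \<epsilon> + Q) * (?k * m)" by (simp add: \<mu>_def)
    have "(R / \<epsilon> + Q) * norm u \<le> \<mu> * m"
      unfolding lm using um \<open>R > 0\<close> \<open>\<epsilon> > 0\<close> Q by (intro mult_left_mono) (auto intro: add_nonneg_nonneg)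
    moreover have "R \<le> R / \<epsilon> * norm u"
      using u\<epsilon> \<open>R > 0\<close> \<open>\<epsilon> > 0\<close> by (simp add: field_simps)
    moreover have "norm (z $ i0) \<le> Q * norm u"
    proof -
      have "norm (line_proj v i0 z) \<le> norm p + norm u"
        unfolding u_def by (rule norm_triangle_sub)
      then have "1 + norm (line_proj v i0 z) \<le> (1 + norm p) + norm u" by simp
      also have "1 + norm p \<le> (1 + norm p) / \<epsilon> * norm u"
        using u\<epsilon> \<open>\<epsilon> > 0\<close> mult_left_mono[OF u\<epsilon>, of "1 + norm p"] by (simp add: pos_le_divide_eq)
      finally have "1 + norm (line_proj v i0 z) \<le> ((1 + norm p) / \<epsilon> + 1) * norm u"
        by (simp add: algebra_simps)
      then have "K * (1 + norm (line_proj v i0 z)) \<le> Q * norm u"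
        unfolding Q_def mult.assoc using \<open>K > 0\<close> by (intro mult_left_mono) auto
      then show ?thesis using K[OF z] by linarith
    qed
    moreover have "0 \<le> Q * norm u" "0 \<le> R / \<epsilon> * norm u" using Q \<open>R > 0\<close> \<open>\<epsilon> > 0\<close> by auto
    ultimately have "R \<le> \<mu> * m" "norm (z $ i0) \<le> \<mu> * m"
      unfolding distrib_right by linarith+
    then show ?thesis using R[OF \<open>1 \<le> i\<close> i(1), of "\<Phi> z"] unfolding \<Phi>j \<Phi>0 by blast
  qed
  ultimately show ?thesis by (intro exI[of _ \<Phi>]) (fastforce simp: not_less[symmetric])
qed

end
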